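(* For all (possibly open) plain terms $t_0,t_1$ of $\lambda_S$, if $t_0\approx_r t_1$ then $t_0\cong^\circ t_1$ (for closed terms, $t_0\cong t_1$).
   Context: Plain calculus $\lambda_S$: terms $t ::= v \mid t\,t \mid \mathcal{S}k.t \mid \langle t\rangle$, values $v ::= x \mid \lambda x.t$; pure contexts $E ::= \square \mid v\,E \mid E\,t$; evaluation contexts $F ::= \square \mid v\,F \mid F\,t \mid \langle F\rangle$; contexts $C ::= \square \mid \lambda x.C \mid t\,C \mid C\,t \mid \mathcal{S}k.C \mid \langle C\rangle$. Reduction: $F[(\lambda x.t)\,v] \to F[t\{v/x\}]$; $F[\langle E[\mathcal{S}k.t]\rangle] \to F[\langle t\{\lambda x.\langle E[x]\rangle/k\}\rangle]$ ($x\notin\mathrm{fv}(E)$); $F[\langle v\rangle]\to F[v]$. $t\Downarrow t'$: $t\to^*t'$ with $t'$ a normal form (value, or non-value that does not reduce); control-stuck term: $E[\mathcal{S}k.t]$. $t_0\cong t_1$ (closed) iff for every closed $C$, $C[t_0]$ evaluates to a value iff $C[t_1]$ does, and $C[t_0]$ evaluates to a control-stuck term iff $C[t_1]$ does; $t_0\cong^\circ t_1$ iff $t_0\sigma\cong t_1\sigma$ for all substitutions $\sigma$ of closed values for free variables. Extended calculus: context variables $\alpha$; terms add $\alpha\langle t\rangle$ (a new construct where $\alpha$ stands for an unknown delimited context); evaluation contexts add $\alpha\langle F\rangle$; delimited contexts $D ::= \langle E\rangle\mid\alpha\langle E\rangle$ (every extended evaluation context is pure or uniquely $F[D]$). Reduction: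 $\beta$ and $F[\langle v\rangle]\to F[v]$ as before, and $F[D[\mathcal{S}k.t]]\to F[\langle t\{\lambda x.D[x]/k\}\rangle]$ ($x\notin\mathrm{fv}(D)$). Normal forms: values, open-stuck $F[x\,v]$, control-stuck $E[\mathcal{S}k.t]$, context-stuck $F[\alpha\langle v\rangle]$. Extensions of $R$ ($x$, $\alpha$ fresh): $E_0\,R^c\,E_1$ (pure) iff $E_0[x]\,R\,E_1[x]$; $F_0[D_0]\,R^c\,F_1[D_1]$ iff $D_0[x]\,R\,D_1[x]$ and $F_0[x]\,R\,F_1[x]$ (no other pairs); $v_0\,R^v\,v_1$ iff $v_0\,x\,R\,v_1\,x$; $F_0[y\,v_0]\,R^{nf}\,F_1[y\,v_1]$ iff $F_0\,R^c\,F_1$ and $v_0\,R^v\,v_1$; $E_0[\mathcal{S}k.t_0]\,R^{nf}\,E_1[\mathcal{S}k.t_1]$ iff $\langle t_0\{\lambda x.\alpha\langle E_0[x]\rangle/k\}\rangle\,R\,\langle t_1\{\lambda x.\alpha\langle E_1[x]\rangle/k\}\rangle$. A refined normal-form bisimulation is a relation $R$ on open extended terms such that $t_0\,R\,t_1$ implies: $t_0\to t_0'$ gives $t_1\to^*t_1'$ with $t_0'\,R\,t_1'$; $t_0$ value gives $t_1\Downarrow v_1$ with $t_0\,R^v\,v_1$; if $t_0=F_0[\alpha\langle v_0\rangle]$ then $t_1\Downarrow F_1[\alpha\langle v_1\rangle]$ with $F_0[\langle\square\rangle]\,R^c\,F_1[\langle\square\rangle]$ and $v_0\,R^v\,v_1$;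 if $t_0$ is open- or control-stuck then $t_1\Downarrow t_1'$ with $t_0\,R^{nf}\,t_1'$; and symmetrically. $\approx_r$ is the largest refined normal-form bisimulation. *)

theory Defs
  imports Main
begin

section \<open>Syntax of the extended calculus\<close>

text \<open>
  Term variables are de Bruijn indices; an index pointing outside all its binders is a free
  variable, so at top level the free variables are simply natural numbers. Context variables
  are never bound and are named by natural numbers. \<open>Shift\<close> (which binds its continuation
  variable) and \<open>Reset\<close> are the two control operators, and \<open>CVar \<alpha> t\<close> is the construct
  \<open>\<alpha>\<langle>t\<rangle>\<close>.
\<close>

datatype trm = Val val | App trm trm | Shift trm | Reset trm | CVar nat trm
  and val = Var nat | Lam trm

primrec fv :: "trm \<Rightarrow> nat set" and fv_val :: "val \<Rightarrow> nat set" where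
  "fv (Val v) = fv_val v"
| "fv (App t s) = fv t \<union> fv s"
| "fv (Shift t) = {n. Suc n \<in> fv t}"
| "fv (Reset t) = fv t"
| "fv (CVar \<alpha> t) = fv t"
| "fv_val (Var n) = {n}"
| "fv_val (Lam t) = {n. Suc n \<in> fv t}"

primrec cv :: "trm \<Rightarrow> nat set" and cv_val :: "val \<Rightarrow> nat set" where
  "cv (Val v) = cv_val v"
| "cv (App t s) = cv t \<union> cv s"
| "cv (Shift t) = cv t"
| "cv (Reset t) = cv t"
| "cv (CVar \<alpha> t) = insert \<alpha> (cv t)"
| "cv_val (Var n) = {}"
| "cv_val (Lam t) = cv t"

definition plain :: "trm \<Rightarrow> bool" where
  "plain t \<longleftrightarrow> cv t = {}"

definition plain_val :: "val \<Rightarrow> bool" where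
  "plain_val v \<longleftrightarrow> cv_val v = {}"

definition closed :: "trm \<Rightarrow> bool" where
  "closed t \<longleftrightarrow> fv t = {}"

definition closed_val :: "val \<Rightarrow> bool" where
  "closed_val v \<longleftrightarrow> fv_val v = {}"

primrec ren :: "(nat \<Rightarrow> nat) \<Rightarrow> trm \<Rightarrow> trm" and ren_val :: "(nat \<Rightarrow> nat) \<Rightarrow> val \<Rightarrow> val" where
  "ren \<rho> (Val v) = Val (ren_val \<rho> v)"
| "ren \<rho> (App t s) = App (ren \<rho> t) (ren \<rho> s)"
| "ren \<rho> (Shift t) = Shift (ren (case_nat 0 (\<lambda>n. Suc (\<rho> n))) t)"
| "ren \<rho> (Reset t) = Reset (ren \<rho> t)"
| "ren \<rho> (CVar \<alpha> t) = CVar \<alpha> (ren \<rho> t)"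
| "ren_val \<rho> (Var n) = Var (\<rho> n)"
| "ren_val \<rho> (Lam t) = Lam (ren (case_nat 0 (\<lambda>n. Suc (\<rho> n))) t)"

definition up :: "(nat \<Rightarrow> val) \<Rightarrow> nat \<Rightarrow> val" where
  "up \<sigma> = case_nat (Var 0) (\<lambda>n. ren_val Suc (\<sigma> n))"

primrec subst :: "(nat \<Rightarrow> val) \<Rightarrow> trm \<Rightarrow> trm" and subst_val :: "(nat \<Rightarrow> val) \<Rightarrow> val \<Rightarrow> val" where
  "subst \<sigma> (Val v) = Val (subst_val \<sigma> v)"
| "subst \<sigma> (App t s) = App (subst \<sigma> t) (subst \<sigma> s)"
| "subst \<sigma> (Shift t) = Shift (subst (up \<sigma>) t)"
| "subst \<sigma> (Reset t) = Reset (subst \<sigma> t)"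
| "subst \<sigma> (CVar \<alpha> t) = CVar \<alpha> (subst \<sigma> t)"
| "subst_val \<sigma> (Var n) = \<sigma> n"
| "subst_val \<sigma> (Lam t) = Lam (subst (up \<sigma>) t)"

text \<open>\<open>inst t v\<close> is \<open>t{v/x}\<close>, where \<open>x\<close> is the variable of the binder whose body is \<open>t\<close>.\<close>

definition inst :: "trm \<Rightarrow> val \<Rightarrow> trm" where
  "inst t v = subst (case_nat v Var) t"


section \<open>Evaluation contexts and reduction\<close>

datatype fctx = FHole | FAppR val fctx | FAppL fctx trm | FReset fctx | FCVar nat fctx

primrec plug :: "fctx \<Rightarrow> trm \<Rightarrow> trm" where
  "plug FHole t = t"
| "plug (FAppR v F) t = App (Val v) (plug F t)"
| "plug (FAppL F s) t = App (plug F t) s"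
| "plug (FReset F) t = Reset (plug F t)"
| "plug (FCVar \<alpha> F) t = CVar \<alpha> (plug F t)"

primrec ctx_comp :: "fctx \<Rightarrow> fctx \<Rightarrow> fctx" where
  "ctx_comp FHole G = G"
| "ctx_comp (FAppR v F) G = FAppR v (ctx_comp F G)"
| "ctx_comp (FAppL F s) G = FAppL (ctx_comp F G) s"
| "ctx_comp (FReset F) G = FReset (ctx_comp F G)"
| "ctx_comp (FCVar \<alpha> F) G = FCVar \<alpha> (ctx_comp F G)"

primrec fv_ctx :: "fctx \<Rightarrow> nat set" where
  "fv_ctx FHole = {}"
| "fv_ctx (FAppR v F) = fv_val v \<union> fv_ctx F"
| "fv_ctx (FAppL F s) = fv_ctx F \<union> fv s"
| "fv_ctx (FReset F) = fv_ctx F"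
| "fv_ctx (FCVar \<alpha> F) = fv_ctx F"

primrec cv_ctx :: "fctx \<Rightarrow> nat set" where
  "cv_ctx FHole = {}"
| "cv_ctx (FAppR v F) = cv_val v \<union> cv_ctx F"
| "cv_ctx (FAppL F s) = cv_ctx F \<union> cv s"
| "cv_ctx (FReset F) = cv_ctx F"
| "cv_ctx (FCVar \<alpha> F) = insert \<alpha> (cv_ctx F)"

primrec ren_ctx :: "(nat \<Rightarrow> nat) \<Rightarrow> fctx \<Rightarrow> fctx" where
  "ren_ctx \<rho> FHole = FHole"
| "ren_ctx \<rho> (FAppR v F) = FAppR (ren_val \<rho> v) (ren_ctx \<rho> F)"
| "ren_ctx \<rho> (FAppL F s) = FAppL (ren_ctx \<rho> F) (ren \<rho> s)"
| "ren_ctx \<rho> (FReset F) = FReset (ren_ctx \<rho> F)"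
| "ren_ctx \<rho> (FCVar \<alpha> F) = FCVar \<alpha> (ren_ctx \<rho> F)"

inductive pure :: "fctx \<Rightarrow> bool" where
  "pure FHole"
| "pure E \<Longrightarrow> pure (FAppR v E)"
| "pure E \<Longrightarrow> pure (FAppL E t)"

inductive delimited :: "fctx \<Rightarrow> bool" where
  "pure E \<Longrightarrow> delimited (FReset E)"
| "pure E \<Longrightarrow> delimited (FCVar \<alpha> E)"

text \<open>
  \<open>reify F\<close> is \<open>\<lambda>x. F[x]\<close> with \<open>x\<close> not free in \<open>F\<close>: shifting the indices of \<open>F\<close> makes the
  new bound variable \<open>0\<close> fresh.
\<close>

definition reify :: "fctx \<Rightarrow> val" where
  "reify F = Lam (plug (ren_ctx Suc F) (Val (Var 0)))"

inductive red :: "trm \<Rightarrow> trm \<Rightarrow> bool" where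
  beta: "red (plug F (App (Val (Lam t)) (Val v))) (plug F (inst t v))"
| shift: "delimited D \<Longrightarrow> red (plug F (plug D (Shift t))) (plug F (Reset (inst t (reify D))))"
| reset: "red (plug F (Reset (Val v))) (plug F (Val v))"

definition is_value :: "trm \<Rightarrow> bool" where
  "is_value t \<longleftrightarrow> (\<exists>v. t = Val v)"

definition normal_form :: "trm \<Rightarrow> bool" where
  "normal_form t \<longleftrightarrow> is_value t \<or> (\<not> is_value t \<and> \<not> (\<exists>t'. red t t'))"

definition evals :: "trm \<Rightarrow> trm \<Rightarrow> bool" (infix "\<Down>" 50) where
  "t \<Down> t' \<longleftrightarrow> red\<^sup>*\<^sup>* t t' \<and> normal_form t'"

definition open_stuck :: "trm \<Rightarrow> bool" where
  "open_stuck t \<longleftrightarrow> (\<exists>F x v. t = plug F (App (Val (Var x)) (Val v)))"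

definition control_stuck :: "trm \<Rightarrow> bool" where
  "control_stuck t \<longleftrightarrow> (\<exists>E s. pure E \<and> t = plug E (Shift s))"


section \<open>Contextual equivalence of plain terms\<close>

lemma cv_plug: "cv (plug F t) = cv_ctx F \<union> cv t"
  by (induction F) auto

text \<open>
  No separate reduction relation is needed for plain terms: on them \<open>red\<close> amounts to the
  reduction rules of the plain calculus.
\<close>

lemma plain_red_iff:
  assumes "plain t"
  shows "red t t' \<longleftrightarrow>
    (\<exists>F s v. cv_ctx F = {} \<and> t = plug F (App (Val (Lam s)) (Val v)) \<and> t' = plug F (inst s v)) \<or>
    (\<exists>F E s. cv_ctx F = {} \<and> cv_ctx E = {} \<and> pure E \<and> t = plug F (Reset (plug E (Shift s))) \<and>
       t' = plug F (Reset (inst s (Lam (Reset (plug (ren_ctx Suc E) (Val (Var 0)))))))) \<or>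
    (\<exists>F v. cv_ctx F = {} \<and> t = plug F (Reset (Val v)) \<and> t' = plug F (Val v))"
    (is "_ \<longleftrightarrow> ?B \<or> ?S \<or> ?R")
proof
  assume "red t t'"
  then show "?B \<or> ?S \<or> ?R"
  proof cases
    case (beta F s v)
    then have "cv_ctx F = {}" using assms by (simp add: plain_def cv_plug)
    with beta(1,2) show ?thesis by (intro disjI1 exI conjI)
  next
    case (shift D F s)
    from shift(3) show ?thesis
    proof cases
      case (1 E)
      then have "cv_ctx F = {}" "cv_ctx E = {}"
        and "t = plug F (Reset (plug E (Shift s)))"
        and "t' = plug F (Reset (inst s (Lam (Reset (plug (ren_ctx Suc E) (Val (Var 0)))))))"
        using assms shift by (simp_all add: plain_def cv_plug reify_def)
      with \<open>pure E\<close> show ?thesis by (intro disjI2[OF disjI1] exI conjI)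
    next
      case (2 E \<alpha>)
      then show ?thesis using assms shift by (auto simp: plain_def cv_plug)
    qed
  next
    case (reset F v)
    then have "cv_ctx F = {}" using assms by (simp add: plain_def cv_plug)
    with reset(1,2) show ?thesis by (intro disjI2[OF disjI2] exI conjI)
  qed
next
  have "red (plug F (Reset (plug E (Shift s))))
      (plug F (Reset (inst s (Lam (Reset (plug (ren_ctx Suc E) (Val (Var 0))))))))"
    if "pure E" for F E s
    using red.shift[OF delimited.intros(1)[OF that], of F s] by (simp add: reify_def)
  then show "red t t'" if "?B \<or> ?S \<or> ?R"
    using that by (elim disjE exE conjE) (simp_all add: red.beta red.reset)
qed

datatype cctx = CHole | CLam cctx | CAppR trm cctx | CAppL cctx trm | CShift cctx | CReset cctx

text \<open>Plugging a term under a binder of a context does not shift indices: variables are captured.\<close>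

primrec cplug :: "cctx \<Rightarrow> trm \<Rightarrow> trm" where
  "cplug CHole t = t"
| "cplug (CLam C) t = Val (Lam (cplug C t))"
| "cplug (CAppR s C) t = App s (cplug C t)"
| "cplug (CAppL C s) t = App (cplug C t) s"
| "cplug (CShift C) t = Shift (cplug C t)"
| "cplug (CReset C) t = Reset (cplug C t)"

primrec fv_cctx :: "cctx \<Rightarrow> nat set" where
  "fv_cctx CHole = {}"
| "fv_cctx (CLam C) = {n. Suc n \<in> fv_cctx C}"
| "fv_cctx (CAppR s C) = fv s \<union> fv_cctx C"
| "fv_cctx (CAppL C s) = fv_cctx C \<union> fv s"
| "fv_cctx (CShift C) = {n. Suc n \<in> fv_cctx C}"
| "fv_cctx (CReset C) = fv_cctx C"

primrec plain_cctx :: "cctx \<Rightarrow> bool" where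
  "plain_cctx CHole \<longleftrightarrow> True"
| "plain_cctx (CLam C) \<longleftrightarrow> plain_cctx C"
| "plain_cctx (CAppR s C) \<longleftrightarrow> plain s \<and> plain_cctx C"
| "plain_cctx (CAppL C s) \<longleftrightarrow> plain_cctx C \<and> plain s"
| "plain_cctx (CShift C) \<longleftrightarrow> plain_cctx C"
| "plain_cctx (CReset C) \<longleftrightarrow> plain_cctx C"

definition closed_cctx :: "cctx \<Rightarrow> bool" where
  "closed_cctx C \<longleftrightarrow> fv_cctx C = {}"

text \<open>Only meant for closed plain terms.\<close>

definition ctx_equiv :: "trm \<Rightarrow> trm \<Rightarrow> bool" (infix "\<cong>" 50) where
  "t\<^sub>0 \<cong> t\<^sub>1 \<longleftrightarrow> (\<forall>C. plain_cctx C \<and> closed_cctx C \<longrightarrow>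
     ((\<exists>v. cplug C t\<^sub>0 \<Down> Val v) \<longleftrightarrow> (\<exists>v. cplug C t\<^sub>1 \<Down> Val v)) \<and>
     ((\<exists>s. control_stuck s \<and> cplug C t\<^sub>0 \<Down> s) \<longleftrightarrow> (\<exists>s. control_stuck s \<and> cplug C t\<^sub>1 \<Down> s)))"

definition open_ctx_equiv :: "trm \<Rightarrow> trm \<Rightarrow> bool" (infix "\<cong>\<degree>" 50) where
  "t\<^sub>0 \<cong>\<degree> t\<^sub>1 \<longleftrightarrow> (\<forall>\<sigma>. (\<forall>x \<in> fv t\<^sub>0 \<union> fv t\<^sub>1. plain_val (\<sigma> x) \<and> closed_val (\<sigma> x)) \<longrightarrow>
     subst \<sigma> t\<^sub>0 \<cong> subst \<sigma> t\<^sub>1)"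


section \<open>Refined normal-form bisimilarity\<close>

text \<open>
  Freshness is existential: one fresh \<open>x\<close> (resp. \<open>\<alpha>\<close>) has to work. This admits the most
  bisimulations; since bisimilarity is invariant under injective renaming, asking for all
  fresh names gives the same bisimilarity.
\<close>

inductive rel_val :: "(trm \<Rightarrow> trm \<Rightarrow> bool) \<Rightarrow> val \<Rightarrow> val \<Rightarrow> bool" for R where
  "x \<notin> fv_val v\<^sub>0 \<union> fv_val v\<^sub>1 \<Longrightarrow> R (App (Val v\<^sub>0) (Val (Var x))) (App (Val v\<^sub>1) (Val (Var x))) \<Longrightarrow>
   rel_val R v\<^sub>0 v\<^sub>1"

inductive rel_ctx :: "(trm \<Rightarrow> trm \<Rightarrow> bool) \<Rightarrow> fctx \<Rightarrow> fctx \<Rightarrow> bool" for R where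
  pure: "pure E\<^sub>0 \<Longrightarrow> pure E\<^sub>1 \<Longrightarrow> x \<notin> fv_ctx E\<^sub>0 \<union> fv_ctx E\<^sub>1 \<Longrightarrow>
   R (plug E\<^sub>0 (Val (Var x))) (plug E\<^sub>1 (Val (Var x))) \<Longrightarrow>
   rel_ctx R E\<^sub>0 E\<^sub>1"
| delimited: "delimited D\<^sub>0 \<Longrightarrow> delimited D\<^sub>1 \<Longrightarrow>
   x \<notin> fv_ctx F\<^sub>0 \<union> fv_ctx D\<^sub>0 \<union> fv_ctx F\<^sub>1 \<union> fv_ctx D\<^sub>1 \<Longrightarrow>
   R (plug D\<^sub>0 (Val (Var x))) (plug D\<^sub>1 (Val (Var x))) \<Longrightarrow>
   R (plug F\<^sub>0 (Val (Var x))) (plug F\<^sub>1 (Val (Var x))) \<Longrightarrow>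
   rel_ctx R (ctx_comp F\<^sub>0 D\<^sub>0) (ctx_comp F\<^sub>1 D\<^sub>1)"

inductive rel_nf :: "(trm \<Rightarrow> trm \<Rightarrow> bool) \<Rightarrow> trm \<Rightarrow> trm \<Rightarrow> bool" for R where
  open_stuck: "rel_ctx R F\<^sub>0 F\<^sub>1 \<Longrightarrow> rel_val R v\<^sub>0 v\<^sub>1 \<Longrightarrow>
   rel_nf R (plug F\<^sub>0 (App (Val (Var y)) (Val v\<^sub>0))) (plug F\<^sub>1 (App (Val (Var y)) (Val v\<^sub>1)))"
| control_stuck: "pure E\<^sub>0 \<Longrightarrow> pure E\<^sub>1 \<Longrightarrow>
   \<alpha> \<notin> cv_ctx E\<^sub>0 \<union> cv t\<^sub>0 \<union> cv_ctx E\<^sub>1 \<union> cv t\<^sub>1 \<Longrightarrow>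
   R (Reset (inst t\<^sub>0 (reify (FCVar \<alpha> E\<^sub>0)))) (Reset (inst t\<^sub>1 (reify (FCVar \<alpha> E\<^sub>1)))) \<Longrightarrow>
   rel_nf R (plug E\<^sub>0 (Shift t\<^sub>0)) (plug E\<^sub>1 (Shift t\<^sub>1))"

definition refined_simulation :: "(trm \<Rightarrow> trm \<Rightarrow> bool) \<Rightarrow> bool" where
  "refined_simulation R \<longleftrightarrow> (\<forall>t\<^sub>0 t\<^sub>1. R t\<^sub>0 t\<^sub>1 \<longrightarrow>
     (\<forall>t\<^sub>0'. red t\<^sub>0 t\<^sub>0' \<longrightarrow> (\<exists>t\<^sub>1'. red\<^sup>*\<^sup>* t\<^sub>1 t\<^sub>1' \<and> R t\<^sub>0' t\<^sub>1')) \<and>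
     (\<forall>v\<^sub>0. t\<^sub>0 = Val v\<^sub>0 \<longrightarrow> (\<exists>v\<^sub>1. t\<^sub>1 \<Down> Val v\<^sub>1 \<and> rel_val R v\<^sub>0 v\<^sub>1)) \<and>
     (\<forall>F\<^sub>0 \<alpha> v\<^sub>0. t\<^sub>0 = plug F\<^sub>0 (CVar \<alpha> (Val v\<^sub>0)) \<longrightarrow>
        (\<exists>F\<^sub>1 v\<^sub>1. t\<^sub>1 \<Down> plug F\<^sub>1 (CVar \<alpha> (Val v\<^sub>1)) \<and>
           rel_ctx R (ctx_comp F\<^sub>0 (FReset FHole)) (ctx_comp F\<^sub>1 (FReset FHole)) \<and> rel_val R v\<^sub>0 v\<^sub>1)) \<and>
     (open_stuck t\<^sub>0 \<or> control_stuck t\<^sub>0 \<longrightarrow> (\<exists>t\<^sub>1'. t\<^sub>1 \<Down> t\<^sub>1' \<and> rel_nf R t\<^sub>0 t\<^sub>1')))"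

definition refined_bisimulation :: "(trm \<Rightarrow> trm \<Rightarrow> bool) \<Rightarrow> bool" where
  "refined_bisimulation R \<longleftrightarrow> refined_simulation R \<and> refined_simulation R\<inverse>\<inverse>"

definition refined_bisimilar :: "trm \<Rightarrow> trm \<Rightarrow> bool" (infix "\<approx>\<^sub>r" 50) where
  "t\<^sub>0 \<approx>\<^sub>r t\<^sub>1 \<longleftrightarrow> (\<exists>R. refined_bisimulation R \<and> R t\<^sub>0 t\<^sub>1)"

lemma rel_val_mono: "R \<le> S \<Longrightarrow> rel_val R \<le> rel_val S"
  by (auto elim!: rel_val.cases intro: rel_val.intros)

lemma rel_ctx_mono: "R \<le> S \<Longrightarrow> rel_ctx R \<le> rel_ctx S"
  by (rule predicate2I, erule rel_ctx.cases) (blast intro: rel_ctx.intros)+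

lemma rel_nf_mono:
  assumes "R \<le> S"
  shows "rel_nf R \<le> rel_nf S"
proof (rule predicate2I)
  fix t\<^sub>0 t\<^sub>1
  assume "rel_nf R t\<^sub>0 t\<^sub>1"
  then show "rel_nf S t\<^sub>0 t\<^sub>1"
  proof cases
    case open_stuck
    then show ?thesis
      using rel_val_mono[OF assms] rel_ctx_mono[OF assms] by (auto intro: rel_nf.open_stuck)
  next
    case (control_stuck E\<^sub>0 E\<^sub>1 \<alpha> s\<^sub>0 s\<^sub>1)
    show ?thesis
      unfolding control_stuck(1,2)
      by (rule rel_nf.control_stuck, fact+) (rule predicate2D[OF assms control_stuck(6)])
  qed
qed

lemma refined_simulation_union:
  assumes "\<And>R. R \<in> \<R> \<Longrightarrow> refined_simulation R"
  shows "refined_simulation (\<lambda>t\<^sub>0 t\<^sub>1. \<exists>R \<in> \<R>. R t\<^sub>0 t\<^sub>1)" (is "refined_simulation ?U")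
  unfolding refined_simulation_def
proof (intro allI impI, elim bexE)
  fix t\<^sub>0 t\<^sub>1 R
  assume R: "R \<in> \<R>" "R t\<^sub>0 t\<^sub>1"
  then have le: "R \<le> ?U" by blast
  note mono = rel_val_mono[OF le, THEN predicate2D] rel_ctx_mono[OF le, THEN predicate2D]
    rel_nf_mono[OF le, THEN predicate2D]
  note sim = assms[OF R(1), unfolded refined_simulation_def, THEN spec, THEN spec, THEN mp, OF R(2)]
  note sims = sim[THEN conjunct1] sim[THEN conjunct2, THEN conjunct1]
    sim[THEN conjunct2, THEN conjunct2, THEN conjunct1]
    sim[THEN conjunct2, THEN conjunct2, THEN conjunct2]
  show "(\<forall>t\<^sub>0'. red t\<^sub>0 t\<^sub>0' \<longrightarrow> (\<exists>t\<^sub>1'. red\<^sup>*\<^sup>* t\<^sub>1 t\<^sub>1' \<and> ?U t\<^sub>0' t\<^sub>1')) \<and>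
     (\<forall>v\<^sub>0. t\<^sub>0 = Val v\<^sub>0 \<longrightarrow> (\<exists>v\<^sub>1. t\<^sub>1 \<Down> Val v\<^sub>1 \<and> rel_val ?U v\<^sub>0 v\<^sub>1)) \<and>
     (\<forall>F\<^sub>0 \<alpha> v\<^sub>0. t\<^sub>0 = plug F\<^sub>0 (CVar \<alpha> (Val v\<^sub>0)) \<longrightarrow>
        (\<exists>F\<^sub>1 v\<^sub>1. t\<^sub>1 \<Down> plug F\<^sub>1 (CVar \<alpha> (Val v\<^sub>1)) \<and>
           rel_ctx ?U (ctx_comp F\<^sub>0 (FReset FHole)) (ctx_comp F\<^sub>1 (FReset FHole)) \<and>
           rel_val ?U v\<^sub>0 v\<^sub>1)) \<and>
     (open_stuck t\<^sub>0 \<or> control_stuck t\<^sub>0 \<longrightarrow> (\<exists>t\<^sub>1'. t\<^sub>1 \<Down> t\<^sub>1' \<and> rel_nf ?U t\<^sub>0 t\<^sub>1'))"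
    apply (intro conjI allI impI)
    subgoal by (drule sims(1)[THEN spec, THEN mp], elim exE conjE, intro exI conjI, assumption)
      (erule bexI[OF _ R(1)])
    subgoal by (drule sims(2)[THEN spec, THEN mp], elim exE conjE, intro exI conjI, assumption)
      (erule mono(1))
    subgoal by (drule sims(3)[THEN spec, THEN spec, THEN spec, THEN mp], elim exE conjE,
        intro exI conjI, assumption) (erule mono(2), erule mono(1))
    subgoal by (drule sims(4)[THEN mp], elim exE conjE, intro exI conjI, assumption) (erule mono(3))
    done
qed

lemma refined_bisimilar_bisimulation: "refined_bisimulation (\<approx>\<^sub>r)"
proof -
  let ?B = "{R. refined_bisimulation R}"
  have 1: "refined_simulation (\<lambda>t\<^sub>0 t\<^sub>1. \<exists>R \<in> ?B. R t\<^sub>0 t\<^sub>1)"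
    by (rule refined_simulation_union) (simp add: refined_bisimulation_def)
  have 2: "refined_simulation (\<lambda>t\<^sub>0 t\<^sub>1. \<exists>R \<in> conversep ` ?B. R t\<^sub>0 t\<^sub>1)"
    by (rule refined_simulation_union, erule imageE) (simp add: refined_bisimulation_def)
  have "(\<lambda>t\<^sub>0 t\<^sub>1. \<exists>R \<in> ?B. R t\<^sub>0 t\<^sub>1) = (\<approx>\<^sub>r)"
    "(\<lambda>t\<^sub>0 t\<^sub>1. \<exists>R \<in> conversep ` ?B. R t\<^sub>0 t\<^sub>1) = (\<approx>\<^sub>r)\<inverse>\<inverse>"
    by (simp_all add: fun_eq_iff refined_bisimilar_def)
  with 1 2 show ?thesis by (simp add: refined_bisimulation_def)
qed

lemma refined_bisimilar_greatest: "refined_bisimulation R \<Longrightarrow> R \<le> (\<approx>\<^sub>r)"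
  by (rule predicate2I) (unfold refined_bisimilar_def, rule exI, rule conjI)

end

theory Submission
  imports Defs
begin

text \<open>
  Refined bisimilarity is embedded into a step-indexed logical relation. Related values map
  related arguments to related terms, and related control-stuck terms capture related delimited
  contexts in a related way; the approximation of index \<open>n\<close> observes \<open>n\<close> reductions of the left-hand
  term. A term variable in a bisimulation stands for an arbitrary pair of related values, a context
  variable for an arbitrary pair of related delimited contexts. If \<open>R\<close> is a simulation, then
  \<open>R\<close>-related terms stay related at every index under all such instantiations: in each
  bisimulation clause, either the left-hand term takes a step before the continuation is used, or the
  relation on values and contexts only asks for smaller indices, so strong induction on the index
  applies. The logical relation is compatible with all term constructors and preserves both
  observations.
\<close>

section \<open>Simultaneous substitution for term and context variables\<close>

text \<open>Counterpart of \<open>up\<close>: context variables are never bound, so passing a binder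
  only shifts the term variables inside the contexts.\<close>

abbreviation upc :: "(nat \<Rightarrow> fctx) \<Rightarrow> nat \<Rightarrow> fctx" where
  "upc \<theta> \<equiv> \<lambda>\<alpha>. ren_ctx Suc (\<theta> \<alpha>)"

text \<open>Both sorts of variables are replaced in one pass, so a single composition law
  (\<open>msubst_msubst\<close>) covers every interaction between them.\<close>

primrec msubst :: "(nat \<Rightarrow> val) \<Rightarrow> (nat \<Rightarrow> fctx) \<Rightarrow> trm \<Rightarrow> trm"
  and msubst_val :: "(nat \<Rightarrow> val) \<Rightarrow> (nat \<Rightarrow> fctx) \<Rightarrow> val \<Rightarrow> val" where
  "msubst \<sigma> \<theta> (Val v) = Val (msubst_val \<sigma> \<theta> v)"
| "msubst \<sigma> \<theta> (App t s) = App (msubst \<sigma> \<theta> t) (msubst \<sigma> \<theta> s)"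
| "msubst \<sigma> \<theta> (Shift t) = Shift (msubst (up \<sigma>) (upc \<theta>) t)"
| "msubst \<sigma> \<theta> (Reset t) = Reset (msubst \<sigma> \<theta> t)"
| "msubst \<sigma> \<theta> (CVar \<alpha> t) = plug (\<theta> \<alpha>) (msubst \<sigma> \<theta> t)"
| "msubst_val \<sigma> \<theta> (Var n) = \<sigma> n"
| "msubst_val \<sigma> \<theta> (Lam t) = Lam (msubst (up \<sigma>) (upc \<theta>) t)"

primrec msubst_ctx :: "(nat \<Rightarrow> val) \<Rightarrow> (nat \<Rightarrow> fctx) \<Rightarrow> fctx \<Rightarrow> fctx" where
  "msubst_ctx \<sigma> \<theta> FHole = FHole"
| "msubst_ctx \<sigma> \<theta> (FAppR v F) = FAppR (msubst_val \<sigma> \<theta> v) (msubst_ctx \<sigma> \<theta> F)"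
| "msubst_ctx \<sigma> \<theta> (FAppL F s) = FAppL (msubst_ctx \<sigma> \<theta> F) (msubst \<sigma> \<theta> s)"
| "msubst_ctx \<sigma> \<theta> (FReset F) = FReset (msubst_ctx \<sigma> \<theta> F)"
| "msubst_ctx \<sigma> \<theta> (FCVar \<alpha> F) = ctx_comp (\<theta> \<alpha>) (msubst_ctx \<sigma> \<theta> F)"

text \<open>The identity on context variables; through it ordinary substitution becomes an instance
  of \<open>msubst\<close> and inherits its laws.\<close>

abbreviation cvar_ctx :: "nat \<Rightarrow> fctx" where
  "cvar_ctx \<equiv> \<lambda>\<alpha>. FCVar \<alpha> FHole"

section \<open>Algebra of plugging, renaming and substitution\<close>

lemma plug_ctx_comp: "plug (ctx_comp F G) t = plug F (plug G t)"
  by (induction F) auto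

lemma ctx_comp_assoc: "ctx_comp (ctx_comp F G) H = ctx_comp F (ctx_comp G H)"
  by (induction F) auto

lemma ctx_comp_FHole [simp]: "ctx_comp F FHole = F"
  by (induction F) auto

lemma subst_eq_msubst:
  "subst \<sigma> t = msubst \<sigma> cvar_ctx t"
  "subst_val \<sigma> v = msubst_val \<sigma> cvar_ctx v"
  by (induction t and v arbitrary: \<sigma> and \<sigma>) auto

lemma ren_plug: "ren \<rho> (plug F t) = plug (ren_ctx \<rho> F) (ren \<rho> t)"
  by (induction F) auto

lemma ren_ctx_comp: "ren_ctx \<rho> (ctx_comp F G) = ctx_comp (ren_ctx \<rho> F) (ren_ctx \<rho> G)"
  by (induction F) auto

lemma ren_ren:
  "ren \<rho> (ren \<rho>' t) = ren (\<lambda>n. \<rho> (\<rho>' n)) t"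
  "ren_val \<rho> (ren_val \<rho>' v) = ren_val (\<lambda>n. \<rho> (\<rho>' n)) v"
proof (induction t and v arbitrary: \<rho> \<rho>' and \<rho> \<rho>')
  case (Shift t)
  then show ?case by (simp, intro arg_cong[of _ _ "\<lambda>\<rho>. ren \<rho> t"] ext) (simp split: nat.split)
next
  case (Lam t)
  then show ?case by (simp, intro arg_cong[of _ _ "\<lambda>\<rho>. ren \<rho> t"] ext) (simp split: nat.split)
qed simp_all

lemma ren_ctx_ren_ctx: "ren_ctx \<rho> (ren_ctx \<rho>' F) = ren_ctx (\<lambda>n. \<rho> (\<rho>' n)) F"
  by (induction F) (auto simp: ren_ren)

lemma msubst_plug: "msubst \<sigma> \<theta> (plug F t) = plug (msubst_ctx \<sigma> \<theta> F) (msubst \<sigma> \<theta> t)"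
  by (induction F) (auto simp: plug_ctx_comp)

lemma msubst_ctx_comp:
  "msubst_ctx \<sigma> \<theta> (ctx_comp F G) = ctx_comp (msubst_ctx \<sigma> \<theta> F) (msubst_ctx \<sigma> \<theta> G)"
  by (induction F) (auto simp: ctx_comp_assoc)

lemma msubst_cong:
  "(\<And>x. x \<in> fv t \<Longrightarrow> \<sigma> x = \<sigma>' x) \<Longrightarrow> (\<And>\<alpha>. \<alpha> \<in> cv t \<Longrightarrow> \<theta> \<alpha> = \<theta>' \<alpha>) \<Longrightarrow>
    msubst \<sigma> \<theta> t = msubst \<sigma>' \<theta>' t"
  "(\<And>x. x \<in> fv_val v \<Longrightarrow> \<sigma> x = \<sigma>' x) \<Longrightarrow> (\<And>\<alpha>. \<alpha> \<in> cv_val v \<Longrightarrow> \<theta> \<alpha> = \<theta>' \<alpha>) \<Longrightarrow>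
    msubst_val \<sigma> \<theta> v = msubst_val \<sigma>' \<theta>' v"
proof (induction t and v arbitrary: \<sigma> \<sigma>' \<theta> \<theta>' and \<sigma> \<sigma>' \<theta> \<theta>')
  case (Shift t)
  have "msubst (up \<sigma>) (upc \<theta>) t = msubst (up \<sigma>') (upc \<theta>') t"
    using Shift.prems by (intro Shift.IH) (auto simp: up_def split: nat.split)
  then show ?case by simp
next
  case (Lam t)
  have "msubst (up \<sigma>) (upc \<theta>) t = msubst (up \<sigma>') (upc \<theta>') t"
    using Lam.prems by (intro Lam.IH) (auto simp: up_def split: nat.split)
  then show ?case by simp
next
  case (App t s)
  have "msubst \<sigma> \<theta> t = msubst \<sigma>' \<theta>' t" "msubst \<sigma> \<theta> s = msubst \<sigma>' \<theta>' s"
    using App.prems by (auto intro!: App.IH)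
  then show ?case by simp
next
  case (CVar \<alpha> t)
  have "msubst \<sigma> \<theta> t = msubst \<sigma>' \<theta>' t" using CVar.prems by (auto intro!: CVar.IH)
  with CVar.prems show ?case by simp
next
  case (Val v)
  have "msubst_val \<sigma> \<theta> v = msubst_val \<sigma>' \<theta>' v" using Val.prems by (auto intro!: Val.IH)
  then show ?case by simp
next
  case (Reset t)
  have "msubst \<sigma> \<theta> t = msubst \<sigma>' \<theta>' t" using Reset.prems by (auto intro!: Reset.IH)
  then show ?case by simp
qed simp

lemma msubst_ctx_cong:
  "(\<And>x. x \<in> fv_ctx F \<Longrightarrow> \<sigma> x = \<sigma>' x) \<Longrightarrow> (\<And>\<alpha>. \<alpha> \<in> cv_ctx F \<Longrightarrow> \<theta> \<alpha> = \<theta>' \<alpha>) \<Longrightarrow>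
    msubst_ctx \<sigma> \<theta> F = msubst_ctx \<sigma>' \<theta>' F"
  by (induction F) (auto intro: msubst_cong)

lemma msubst_ren:
  "msubst \<sigma> \<theta> (ren \<rho> t) = msubst (\<lambda>n. \<sigma> (\<rho> n)) \<theta> t"
  "msubst_val \<sigma> \<theta> (ren_val \<rho> v) = msubst_val (\<lambda>n. \<sigma> (\<rho> n)) \<theta> v"
proof (induction t and v arbitrary: \<sigma> \<theta> \<rho> and \<sigma> \<theta> \<rho>)
  case (Shift t)
  then show ?case by (simp, intro msubst_cong) (auto simp: up_def split: nat.split)
next
  case (Lam t)
  then show ?case by (simp, intro msubst_cong) (auto simp: up_def split: nat.split)
qed simp_all

lemma msubst_ctx_ren: "msubst_ctx \<sigma> \<theta> (ren_ctx \<rho> F) = msubst_ctx (\<lambda>n. \<sigma> (\<rho> n)) \<theta> F"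
  by (induction F) (auto simp: msubst_ren)

lemma ren_msubst:
  "ren \<rho> (msubst \<sigma> \<theta> t) = msubst (\<lambda>n. ren_val \<rho> (\<sigma> n)) (\<lambda>\<alpha>. ren_ctx \<rho> (\<theta> \<alpha>)) t"
  "ren_val \<rho> (msubst_val \<sigma> \<theta> v) = msubst_val (\<lambda>n. ren_val \<rho> (\<sigma> n)) (\<lambda>\<alpha>. ren_ctx \<rho> (\<theta> \<alpha>)) v"
proof (induction t and v arbitrary: \<sigma> \<theta> \<rho> and \<sigma> \<theta> \<rho>)
  case (Shift t)
  then show ?case
    by (simp, intro msubst_cong) (auto simp: up_def ren_ren ren_ctx_ren_ctx split: nat.split)
next
  case (Lam t)
  then show ?case
    by (simp, intro msubst_cong) (auto simp: up_def ren_ren ren_ctx_ren_ctx split: nat.split)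
qed (simp_all add: ren_plug)

lemma ren_ctx_msubst_ctx:
  "ren_ctx \<rho> (msubst_ctx \<sigma> \<theta> F) = msubst_ctx (\<lambda>n. ren_val \<rho> (\<sigma> n)) (\<lambda>\<alpha>. ren_ctx \<rho> (\<theta> \<alpha>)) F"
  by (induction F) (auto simp: ren_msubst ren_ctx_comp)

lemma up_simps [simp]: "up \<sigma> 0 = Var 0" "up \<sigma> (Suc n) = ren_val Suc (\<sigma> n)"
  by (simp_all add: up_def)

lemma msubst_up_ren_Suc:
  "msubst_val (up \<sigma>) (upc \<theta>) (ren_val Suc v) = ren_val Suc (msubst_val \<sigma> \<theta> v)"
  "msubst_ctx (up \<sigma>) (upc \<theta>) (ren_ctx Suc F) = ren_ctx Suc (msubst_ctx \<sigma> \<theta> F)"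
  by (simp_all add: msubst_ren msubst_ctx_ren ren_msubst ren_ctx_msubst_ctx)

lemma msubst_msubst:
  "msubst \<sigma>' \<theta>' (msubst \<sigma> \<theta> t) =
    msubst (\<lambda>n. msubst_val \<sigma>' \<theta>' (\<sigma> n)) (\<lambda>\<alpha>. msubst_ctx \<sigma>' \<theta>' (\<theta> \<alpha>)) t"
  "msubst_val \<sigma>' \<theta>' (msubst_val \<sigma> \<theta> v) =
    msubst_val (\<lambda>n. msubst_val \<sigma>' \<theta>' (\<sigma> n)) (\<lambda>\<alpha>. msubst_ctx \<sigma>' \<theta>' (\<theta> \<alpha>)) v"
proof (induction t and v arbitrary: \<sigma> \<theta> \<sigma>' \<theta>' and \<sigma> \<theta> \<sigma>' \<theta>')
  case (Shift t)
  then show ?case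
    by (simp, intro msubst_cong) (auto simp: up_def[of \<sigma>] up_def[of "\<lambda>n. msubst_val \<sigma>' \<theta>' (\<sigma> n)"]
        msubst_up_ren_Suc split: nat.split)
next
  case (Lam t)
  then show ?case
    by (simp, intro msubst_cong) (auto simp: up_def[of \<sigma>] up_def[of "\<lambda>n. msubst_val \<sigma>' \<theta>' (\<sigma> n)"]
        msubst_up_ren_Suc split: nat.split)
qed (simp_all add: msubst_plug)

lemma up_Var: "up Var = Var"
  by (rule ext) (simp add: up_def split: nat.split)

lemma msubst_id [simp]:
  "msubst Var cvar_ctx t = t"
  "msubst_val Var cvar_ctx v = v"
  by (induction t and v) (simp_all add: up_Var)

lemma msubst_ctx_id [simp]: "msubst_ctx Var cvar_ctx F = F"
  by (induction F) simp_all

text \<open>Instantiating a substituted body amounts to extending the substitution at index 0; the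
  shifts made by \<open>up\<close> and \<open>upc\<close> are undone.\<close>

lemma inst_msubst_up:
  "inst (msubst (up \<sigma>) (upc \<theta>) t) w = msubst (case_nat w \<sigma>) \<theta> t"
  unfolding inst_def subst_eq_msubst msubst_msubst
  by (intro msubst_cong) (auto simp: up_def msubst_ren msubst_ctx_ren split: nat.split)

lemma msubst_inst:
  "msubst \<sigma> \<theta> (inst t v) = inst (msubst (up \<sigma>) (upc \<theta>) t) (msubst_val \<sigma> \<theta> v)"
  unfolding inst_msubst_up unfolding inst_def subst_eq_msubst msubst_msubst
  by (intro msubst_cong) (auto split: nat.split)

lemma msubst_reify: "msubst_val \<sigma> \<theta> (reify F) = reify (msubst_ctx \<sigma> \<theta> F)"
  by (simp add: reify_def msubst_plug msubst_up_ren_Suc)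

lemma inst_reify_body: "inst (plug (ren_ctx Suc F) (Val (Var 0))) v = plug F (Val v)"
  by (simp add: inst_def subst_eq_msubst msubst_plug msubst_ctx_ren)

section \<open>Delimited contexts and reduction under substitution\<close>

lemma pure_simps [simp]:
  "pure FHole"
  "pure (FAppR v F) \<longleftrightarrow> pure F"
  "pure (FAppL F s) \<longleftrightarrow> pure F"
  "\<not> pure (FReset F)"
  "\<not> pure (FCVar \<alpha> F)"
  by (subst pure.simps, simp)+

lemma pure_ctx_comp_iff: "pure (ctx_comp F G) \<longleftrightarrow> pure F \<and> pure G"
  by (induction F) auto

lemma pure_msubst_ctx: "pure E \<Longrightarrow> pure (msubst_ctx \<sigma> \<theta> E)"
  by (induction rule: pure.induct) (auto intro: pure.intros)

text \<open>The only contexts allowed to replace a context variable. Their outermost frame is a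
  \<open>Reset\<close>, so an instantiated \<open>CVar\<close> is always a \<open>Reset\<close>
  term.\<close>

inductive reset_ctx :: "fctx \<Rightarrow> bool" where
  "pure E \<Longrightarrow> reset_ctx (FReset E)"

lemma reset_ctx_delimited: "reset_ctx D \<Longrightarrow> delimited D"
  by (auto elim: reset_ctx.cases intro: delimited.intros)

lemma reset_ctx_comp: "reset_ctx D \<Longrightarrow> pure E \<Longrightarrow> reset_ctx (ctx_comp D E)"
  by (auto elim!: reset_ctx.cases intro!: reset_ctx.intros simp: pure_ctx_comp_iff)

lemma reset_ctx_msubst_ctx:
  "delimited D \<Longrightarrow> (\<And>\<alpha>. reset_ctx (\<theta> \<alpha>)) \<Longrightarrow> reset_ctx (msubst_ctx \<sigma> \<theta> D)"
  by (erule delimited.cases) (auto intro: reset_ctx.intros reset_ctx_comp pure_msubst_ctx)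

text \<open>In a shift step, \<open>FCVar \<alpha> E\<close> becomes
  \<open>\<theta> \<alpha>\<close> composed with a pure context, which is still delimited. Hence one
  step yields exactly one step, as step counting requires.\<close>

lemma red_msubst:
  assumes "red t t'" and \<theta>: "\<And>\<alpha>. reset_ctx (\<theta> \<alpha>)"
  shows "red (msubst \<sigma> \<theta> t) (msubst \<sigma> \<theta> t')"
  using assms(1)
proof cases
  case (shift D F s)
  show ?thesis
    unfolding shift(1,2) msubst_plug
    using red.shift[OF reset_ctx_delimited[OF reset_ctx_msubst_ctx[OF shift(3) \<theta>]]]
    by (simp add: msubst_inst msubst_reify)
qed (auto simp: msubst_plug msubst_inst intro: red.beta red.reset)

lemma reds_msubst:
  assumes "red\<^sup>*\<^sup>* t t'" and "\<And>\<alpha>. reset_ctx (\<theta> \<alpha>)"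
  shows "red\<^sup>*\<^sup>* (msubst \<sigma> \<theta> t) (msubst \<sigma> \<theta> t')"
  using assms(1) by induction (auto intro: rtranclp.rtrancl_into_rtrancl red_msubst assms(2))

lemma red_plug: "red t t' \<Longrightarrow> red (plug F t) (plug F t')"
  by (erule red.cases) (metis plug_ctx_comp red.intros)+

lemma reds_plug: "red\<^sup>*\<^sup>* t t' \<Longrightarrow> red\<^sup>*\<^sup>* (plug F t) (plug F t')"
  by (induction rule: rtranclp_induct) (auto intro: rtranclp.rtrancl_into_rtrancl red_plug)


section \<open>Unique decomposition\<close>

text \<open>What an evaluation context focuses on, whether reducible or stuck. A
  \<open>Shift\<close> counts by itself, although its step also needs the surrounding delimited
  context.\<close>

inductive head :: "trm \<Rightarrow> bool" where
  "head (App (Val v) (Val w))"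
| "head (Shift t)"
| "head (Reset (Val v))"
| "head (CVar \<alpha> (Val v))"

lemma plug_eq_Val_iff:
  "plug F t = Val v \<longleftrightarrow> F = FHole \<and> t = Val v"
  "Val v = plug F t \<longleftrightarrow> F = FHole \<and> t = Val v"
  by (cases F; auto)+

lemma head_not_Val: "head h \<Longrightarrow> h \<noteq> Val v"
  by (auto elim: head.cases)

lemma head_eq_plug: "head h \<Longrightarrow> h = plug F t \<Longrightarrow> (\<And>v. t \<noteq> Val v) \<Longrightarrow> F = FHole"
  by (cases F) (auto elim!: head.cases simp: plug_eq_Val_iff)

text \<open>A head has no non-value in evaluation position, so neither context can end strictly
  above the other. This gives determinism and separates the kinds of stuck terms.\<close>

lemma plug_head_unique:
  "plug F h = plug F' h' \<Longrightarrow> head h \<Longrightarrow> head h' \<Longrightarrow> F = F' \<and> h = h'"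
proof (induction F arbitrary: F')
  case FHole
  then have "F' = FHole" using head_eq_plug[of h F' h'] head_not_Val by auto
  with FHole show ?case by simp
next
  case (FAppR v F)
  then have "F' \<noteq> FHole" using head_eq_plug[of h' "FAppR v F" h] head_not_Val by fastforce
  with FAppR show ?case by (cases F') (auto simp: plug_eq_Val_iff head_not_Val)
next
  case (FAppL F s)
  then have "F' \<noteq> FHole" using head_eq_plug[of h' "FAppL F s" h] head_not_Val by fastforce
  with FAppL show ?case by (cases F') (auto simp: plug_eq_Val_iff head_not_Val)
next
  case (FReset F)
  then have "F' \<noteq> FHole" using head_eq_plug[of h' "FReset F" h] head_not_Val by fastforce
  with FReset show ?case by (cases F') auto
next
  case (FCVar \<alpha> F)
  then have "F' \<noteq> FHole" using head_eq_plug[of h' "FCVar \<alpha> F" h] head_not_Val by fastforce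
  with FCVar show ?case by (cases F') auto
qed

lemma Val_or_head:
  obtains v where "t = Val v" | F h where "t = plug F h" "head h"
proof -
  have "(\<exists>v. t = Val v) \<or> (\<exists>F h. t = plug F h \<and> head h)"
  \<comment> \<open>Values need no decomposition, so their predicate in the mutual induction is
    trivial.\<close>
  proof (induction t rule: trm.induct[where ?P2.0 = "\<lambda>_. True"])
    case (App t s)
    show ?case
    proof (cases "\<exists>v. t = Val v")
      case False
      with App obtain F h where "t = plug F h" "head h" by blast
      then show ?thesis by (intro disjI2 exI[of _ "FAppL F s"]) auto
    next
      case True
      then obtain v where v: "t = Val v" ..
      from App.IH(2) show ?thesis
      proof (elim disjE exE conjE)
        fix F h assume "s = plug F h" "head h"
        then show ?thesis using v by (intro disjI2 exI[of _ "FAppR v F"]) auto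
      qed (use v in \<open>auto intro!: exI[of _ FHole] head.intros\<close>)
    qed
  next
    case (Shift t)
    show ?case by (intro disjI2 exI[of _ FHole]) (auto intro: head.intros)
  next
    case (Reset t)
    then show ?case
    proof (elim disjE exE conjE)
      fix F h assume "t = plug F h" "head h"
      then show ?thesis by (intro disjI2 exI[of _ "FReset F"]) auto
    qed (auto intro!: exI[of _ FHole] head.intros)
  next
    case (CVar \<alpha> t)
    then show ?case
    proof (elim disjE exE conjE)
      fix F h assume "t = plug F h" "head h"
      then show ?thesis by (intro disjI2 exI[of _ "FCVar \<alpha> F"]) auto
    qed (auto intro!: exI[of _ FHole] head.intros)
  qed auto
  then show thesis using that by blast
qed

text \<open>A pure context contains no delimiter, so \<open>D\<close> must begin at the delimiter
  closest to the hole.\<close>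

lemma ctx_comp_delimited_unique:
  "ctx_comp F D = ctx_comp F' D' \<Longrightarrow> delimited D \<Longrightarrow> delimited D' \<Longrightarrow> F = F' \<and> D = D'"
proof (induction F arbitrary: F')
  case FHole
  then show ?case by (cases F') (auto elim!: delimited.cases simp: pure_ctx_comp_iff)
next
  case (FAppR v F)
  then show ?case by (cases F') (auto elim!: delimited.cases)
next
  case (FAppL F s)
  then show ?case by (cases F') (auto elim!: delimited.cases)
next
  case (FReset F)
  then show ?case
    by (cases F') (auto elim!: delimited.cases simp: pure_ctx_comp_iff)
next
  case (FCVar \<alpha> F)
  then show ?case
    by (cases F') (auto elim!: delimited.cases simp: pure_ctx_comp_iff)
qed

lemma pure_or_delimited:
  obtains "pure F" | F' D where "F = ctx_comp F' D" "delimited D"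
proof -
  have "pure F \<or> (\<exists>F' D. F = ctx_comp F' D \<and> delimited D)"
  proof (induction F)
    case (FAppR v F)
    then show ?case by (metis pure.intros(2) ctx_comp.simps(2))
  next
    case (FAppL F s)
    then show ?case by (metis pure.intros(3) ctx_comp.simps(3))
  next
    case (FReset F)
    then show ?case by (metis delimited.intros(1) ctx_comp.simps(1,4))
  next
    case (FCVar \<alpha> F)
    then show ?case by (metis delimited.intros(2) ctx_comp.simps(1,5))
  qed (auto intro: pure.intros)
  then show thesis using that by blast
qed

section \<open>Determinism and the possible shapes of a term\<close>

lemma red_head_cases:
  assumes "red (plug F h) t'" and h: "head h"
  obtains (beta) s v where "h = App (Val (Lam s)) (Val v)" "t' = plug F (inst s v)"
  | (shift) F' D s where "F = ctx_comp F' D" "delimited D" "h = Shift s"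
      "t' = plug F' (Reset (inst s (reify D)))"
  | (reset) v where "h = Reset (Val v)" "t' = plug F (Val v)"
  using assms(1)
proof cases
  case (beta F' s v)
  with plug_head_unique[OF beta(1) h head.intros(1)] that(1) show ?thesis by blast
next
  case (shift D F' s)
  then have "plug F h = plug (ctx_comp F' D) (Shift s)" by (simp add: plug_ctx_comp)
  from plug_head_unique[OF this h head.intros(2)] that(2) shift show ?thesis by blast
next
  case (reset F' v)
  with plug_head_unique[OF reset(1) h head.intros(3)] that(3) show ?thesis by blast
qed

lemma not_red_Val: "\<not> red (Val v) t"
  by (auto elim!: red.cases simp: plug_eq_Val_iff)

lemma not_red_control_stuck:
  assumes "pure E"
  shows "\<not> red (plug E (Shift s)) t"
proof
  assume "red (plug E (Shift s)) t"
  then show False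
    by (rule red_head_cases) (use assms in \<open>auto intro: head.intros simp: pure_ctx_comp_iff elim: delimited.cases\<close>)
qed

lemma red_deterministic:
  assumes "red t t'" "red t t''"
  shows "t' = t''"
proof (cases t rule: Val_or_head)
  case (1 v)
  with assms not_red_Val show ?thesis by blast
next
  case (2 F h)
  from assms(1)[unfolded 2(1)] 2(2) show ?thesis
    by (cases rule: red_head_cases; use assms(2)[unfolded 2(1)] 2(2) in \<open>cases rule: red_head_cases\<close>)
       (auto dest: ctx_comp_delimited_unique)
qed

text \<open>The surrounding context takes part in a step only when \<open>t\<close> is a value or
  when a \<open>Shift\<close> in \<open>t\<close> captures beyond \<open>t\<close>; both are
  excluded.\<close>

lemma red_plug_cases:
  assumes "red (plug F t) t'" "\<not> is_value t" "\<not> control_stuck t"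
  obtains s where "red t s" "t' = plug F s"
proof (cases t rule: Val_or_head)
  case (1 v)
  with assms show ?thesis by (simp add: is_value_def)
next
  case (2 G h)
  then have "red (plug (ctx_comp F G) h) t'" using assms by (simp add: plug_ctx_comp)
  then show ?thesis using \<open>head h\<close>
  proof (cases rule: red_head_cases)
    case (beta s v)
    then show ?thesis using 2 that[of "plug G (inst s v)"] red.beta by (simp add: plug_ctx_comp)
  next
    case (shift F' D s)
    show ?thesis
    proof (cases G rule: pure_or_delimited)
      case 1
      with assms(3) 2 shift show ?thesis by (auto simp: control_stuck_def)
    next
      \<comment> \<open>The nearest delimiter already lies inside \<open>t\<close>, so the capture
        is a step of \<open>t\<close> alone.\<close>
      case G: (2 G' D')
      with shift(1,2) have "F' = ctx_comp F G'" "D' = D"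
        using ctx_comp_delimited_unique[of "ctx_comp F G'" D' F' D] by (auto simp: ctx_comp_assoc)
      then show ?thesis using 2 shift G that[of "plug G' (Reset (inst s (reify D)))"] red.shift[OF \<open>delimited D\<close>]
        by (simp add: plug_ctx_comp)
    qed
  next
    case (reset v)
    then show ?thesis using 2 that[of "plug G (Val v)"] red.reset by (simp add: plug_ctx_comp)
  qed
qed

lemma control_stuck_plug:
  assumes "plug F t = plug E (Shift s)" "pure E" "\<not> is_value t"
  shows "control_stuck t"
proof (cases t rule: Val_or_head)
  case (1 v)
  with assms show ?thesis by (simp add: is_value_def)
next
  case (2 G h)
  with assms have "plug (ctx_comp F G) h = plug E (Shift s)" by (simp add: plug_ctx_comp)
  from plug_head_unique[OF this 2(2) head.intros(2)] 2 assms(2) show ?thesis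
    by (auto simp: control_stuck_def pure_ctx_comp_iff)
qed

lemma term_cases:
  obtains (red) t' where "red t t'"
  | (val) v where "t = Val v"
  | (open_stuck) F y v where "t = plug F (App (Val (Var y)) (Val v))"
  | (control_stuck) E s where "pure E" "t = plug E (Shift s)"
  | (ctx_stuck) F \<alpha> v where "t = plug F (CVar \<alpha> (Val v))"
proof (cases t rule: Val_or_head)
  case (1 v)
  then show ?thesis by (rule val)
next
  case (2 F h)
  from 2(2) show ?thesis
  proof cases
    case (1 v w)
    then show ?thesis using 2 open_stuck red red.beta by (cases v) blast+
  next
    case (2 s)
    show ?thesis
    proof (cases F rule: pure_or_delimited)
      case 1
      then show ?thesis using 2 \<open>t = plug F h\<close> control_stuck by blast
    next
      case (2 F' D)
      then show ?thesis
        using \<open>t = plug F h\<close> \<open>h = Shift s\<close> red[of "plug F' (Reset (inst s (reify D)))"]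
          red.shift[OF 2(2)] by (simp add: plug_ctx_comp)
    qed
  next
    case (3 v)
    then show ?thesis using 2 red red.reset by blast
  next
    case (4 \<alpha> v)
    then show ?thesis using 2 ctx_stuck by auto
  qed
qed


section \<open>The logical relation\<close>

text \<open>
  Terms that get stuck on a free variable or on a context variable are related to everything, so
  closedness never has to be tracked.
\<close>

function vrel :: "nat \<Rightarrow> val \<Rightarrow> val \<Rightarrow> bool" and trel :: "nat \<Rightarrow> trm \<Rightarrow> trm \<Rightarrow> bool" where
  "vrel n v0 v1 \<longleftrightarrow> (\<forall>m. m < n \<longrightarrow> (\<forall>u0 u1. vrel m u0 u1 \<longrightarrow>
     (\<forall>t. red (App (Val v0) (Val u0)) t \<longrightarrow> trel m t (App (Val v1) (Val u1)))))"
| "trel n t0 t1 \<longleftrightarrow>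
     (\<forall>m. n = Suc m \<longrightarrow> (\<forall>t. red t0 t \<longrightarrow> trel m t t1)) \<and>
     (\<forall>v0. t0 = Val v0 \<longrightarrow> (\<exists>v1. red\<^sup>*\<^sup>* t1 (Val v1) \<and> vrel n v0 v1)) \<and>
     (\<forall>E0 s0. pure E0 \<and> t0 = plug E0 (Shift s0) \<longrightarrow>
        (\<exists>E1 s1. pure E1 \<and> red\<^sup>*\<^sup>* t1 (plug E1 (Shift s1)) \<and>
          (\<forall>m. m < n \<longrightarrow> (\<forall>D0 D1. reset_ctx D0 \<and> reset_ctx D1 \<and>
             (\<forall>k. k \<le> m \<longrightarrow> (\<forall>u0 u1. vrel k u0 u1 \<longrightarrow> trel k (plug D0 (Val u0)) (plug D1 (Val u1)))) \<longrightarrow>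
             trel m (Reset (inst s0 (reify (ctx_comp D0 E0)))) (Reset (inst s1 (reify (ctx_comp D1 E1))))))))"
  by pat_completeness auto
termination
  \<comment> \<open>At equal index \<open>trel\<close> calls \<open>vrel\<close> but not conversely,
    hence the extra 1 in the weight of \<open>trel\<close>.\<close>
  by (relation "measure (case_sum (\<lambda>(n, _). 2 * n) (\<lambda>(n, _). 2 * n + 1))") auto

declare vrel.simps [simp del] trel.simps [simp del]

text \<open>Names the condition on captured contexts in the last clause of \<open>trel\<close>.
  Ranging over all indices up to \<open>n\<close> makes it downward closed at once.\<close>

definition crel :: "nat \<Rightarrow> fctx \<Rightarrow> fctx \<Rightarrow> bool" where
  "crel n F0 F1 \<longleftrightarrow> (\<forall>k. k \<le> n \<longrightarrow> (\<forall>u0 u1. vrel k u0 u1 \<longrightarrow>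
     trel k (plug F0 (Val u0)) (plug F1 (Val u1))))"

text \<open>The rest of that clause. The strict bound on \<open>m\<close> accounts for the capture
  step, which happens only once a delimiter is supplied.\<close>

definition stuck_rel :: "nat \<Rightarrow> fctx \<Rightarrow> trm \<Rightarrow> fctx \<Rightarrow> trm \<Rightarrow> bool" where
  "stuck_rel n E0 s0 E1 s1 \<longleftrightarrow> (\<forall>m. m < n \<longrightarrow> (\<forall>D0 D1. reset_ctx D0 \<and> reset_ctx D1 \<and> crel m D0 D1 \<longrightarrow>
     trel m (Reset (inst s0 (reify (ctx_comp D0 E0)))) (Reset (inst s1 (reify (ctx_comp D1 E1))))))"

lemmas trel_unfold = trel.simps[folded crel_def, folded stuck_rel_def]

section \<open>Introduction, elimination and monotonicity rules\<close>

lemma vrelI: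
  "(\<And>m u0 u1 t. m < n \<Longrightarrow> vrel m u0 u1 \<Longrightarrow> red (App (Val v0) (Val u0)) t \<Longrightarrow>
     trel m t (App (Val v1) (Val u1))) \<Longrightarrow> vrel n v0 v1"
  by (simp add: vrel.simps[of n])

lemma vrelD:
  "vrel n v0 v1 \<Longrightarrow> m < n \<Longrightarrow> vrel m u0 u1 \<Longrightarrow> red (App (Val v0) (Val u0)) t \<Longrightarrow>
     trel m t (App (Val v1) (Val u1))"
  by (simp add: vrel.simps[of n])

lemma crelD: "crel n F0 F1 \<Longrightarrow> vrel n u0 u1 \<Longrightarrow> trel n (plug F0 (Val u0)) (plug F1 (Val u1))"
  by (simp add: crel_def)

lemma trel_redD: "trel (Suc n) t0 t1 \<Longrightarrow> red t0 t \<Longrightarrow> trel n t t1"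
  by (simp add: trel_unfold[of "Suc n"])

lemma trel_ValD: "trel n (Val v0) t1 \<Longrightarrow> \<exists>v1. red\<^sup>*\<^sup>* t1 (Val v1) \<and> vrel n v0 v1"
  by (simp add: trel_unfold[of n])

lemma trel_stuckD:
  "trel n (plug E0 (Shift s0)) t1 \<Longrightarrow> pure E0 \<Longrightarrow>
    \<exists>E1 s1. pure E1 \<and> red\<^sup>*\<^sup>* t1 (plug E1 (Shift s1)) \<and> stuck_rel n E0 s0 E1 s1"
  unfolding trel_unfold[of n] by blast

lemma trel_stepI:
  assumes "\<not> is_value t0" "\<not> control_stuck t0" "\<And>m t. n = Suc m \<Longrightarrow> red t0 t \<Longrightarrow> trel m t t1"
  shows "trel n t0 t1"
  using assms unfolding trel_unfold[of n] is_value_def control_stuck_def by blast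

text \<open>By determinism a single reduct is enough to check, and a term that reduces is neither a
  value nor control-stuck.\<close>

lemma trel_redI:
  assumes "red t0 t" "\<And>m. n = Suc m \<Longrightarrow> trel m t t1"
  shows "trel n t0 t1"
proof (rule trel_stepI)
  show "\<not> is_value t0" "\<not> control_stuck t0"
    using assms(1) not_red_Val not_red_control_stuck by (auto simp: is_value_def control_stuck_def)
qed (use assms red_deterministic in blast)

lemma trel_ValI: "red\<^sup>*\<^sup>* t1 (Val v1) \<Longrightarrow> vrel n v0 v1 \<Longrightarrow> trel n (Val v0) t1"
  by (auto simp: trel_unfold[of n] not_red_Val plug_eq_Val_iff)

lemma trel_stuckI:
  assumes "pure E0" "pure E1" "red\<^sup>*\<^sup>* t1 (plug E1 (Shift s1))" "stuck_rel n E0 s0 E1 s1"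
  shows "trel n (plug E0 (Shift s0)) t1"
  unfolding trel_unfold[of n]
proof (intro conjI allI impI; (elim conjE)?)
  fix E0' s0' assume "pure E0'" "plug E0 (Shift s0) = plug E0' (Shift s0')"
  with plug_head_unique[OF this(2)] have "E0' = E0" "s0' = s0" by (auto intro: head.intros)
  with assms show "\<exists>E1 s1. pure E1 \<and> red\<^sup>*\<^sup>* t1 (plug E1 (Shift s1)) \<and> stuck_rel n E0' s0' E1 s1" by blast
qed (auto simp: plug_eq_Val_iff not_red_control_stuck[OF assms(1)])

lemma value_or_control_stuck_cases:
  obtains (val) v where "t = Val v" | (stuck) E s where "pure E" "t = plug E (Shift s)"
  | (other) "\<not> is_value t" "\<not> control_stuck t"
  unfolding is_value_def control_stuck_def by blast

text \<open>Only left-hand steps are counted, so the right-hand term may be expanded at no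
  cost.\<close>

lemma trel_reds: "trel n t0 t1 \<Longrightarrow> red\<^sup>*\<^sup>* s t1 \<Longrightarrow> trel n t0 s"
proof (induction n arbitrary: t0 rule: less_induct)
  case (less n)
  show ?case
  proof (cases t0 rule: value_or_control_stuck_cases)
    case (val v)
    with less.prems show ?thesis by (metis trel_ValD trel_ValI rtranclp_trans)
  next
    case (stuck E s')
    with less.prems show ?thesis by (metis trel_stuckD trel_stuckI rtranclp_trans)
  next
    case other
    then show ?thesis by (rule trel_stepI) (use less in \<open>blast dest: trel_redD\<close>)
  qed
qed

lemma vrel_mono: "vrel n v0 v1 \<Longrightarrow> k \<le> n \<Longrightarrow> vrel k v0 v1"
  by (metis vrelI vrelD less_le_trans)

lemma crel_mono: "crel n F0 F1 \<Longrightarrow> k \<le> n \<Longrightarrow> crel k F0 F1"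
  by (auto simp: crel_def)

lemma stuck_rel_mono: "stuck_rel n E0 s0 E1 s1 \<Longrightarrow> k \<le> n \<Longrightarrow> stuck_rel k E0 s0 E1 s1"
  by (auto simp: stuck_rel_def)

lemma trel_mono: "trel n t0 t1 \<Longrightarrow> k \<le> n \<Longrightarrow> trel k t0 t1"
proof (induction n arbitrary: t0 k)
  case 0
  then show ?case by simp
next
  case (Suc n)
  show ?case
  proof (cases t0 rule: value_or_control_stuck_cases)
    case (val v)
    with Suc.prems show ?thesis by (metis trel_ValD trel_ValI vrel_mono)
  next
    case (stuck E s)
    with Suc.prems show ?thesis by (metis trel_stuckD trel_stuckI stuck_rel_mono)
  next
    case other
    then show ?thesis by (rule trel_stepI) (use Suc in \<open>blast dest: trel_redD\<close>)
  qed
qed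

text \<open>Every step of the filled context is a step of \<open>t0\<close>, and that step lowers
  the index. The contexts are therefore compared only below \<open>n\<close>, which later makes
  induction hypotheses applicable.\<close>

lemma trel_plug_stepI:
  assumes "trel n t0 t1" "\<not> is_value t0" "\<not> control_stuck t0"
    and "\<And>m s. n = Suc m \<Longrightarrow> trel m s t1 \<Longrightarrow> red t0 s \<Longrightarrow> trel m (plug F0 s) (plug F1 t1)"
  shows "trel n (plug F0 t0) (plug F1 t1)"
proof (rule trel_stepI)
  show "\<not> is_value (plug F0 t0)" using assms(2) by (auto simp: is_value_def plug_eq_Val_iff)
  show "\<not> control_stuck (plug F0 t0)"
    using assms(2,3) control_stuck_plug by (metis control_stuck_def)
next
  fix m t assume "n = Suc m" "red (plug F0 t0) t"
  with assms show "trel m t (plug F1 t1)" by (metis red_plug_cases trel_redD)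
qed

text \<open>A control-stuck term passes its capture on to a pure context and performs it in a
  delimited one; requiring the same shape on both sides keeps the two captures in step.\<close>

lemma trel_plug:
  assumes "trel n t0 t1" "crel n F0 F1"
    and "pure F0 \<and> pure F1 \<or> reset_ctx F0 \<and> reset_ctx F1"
  shows "trel n (plug F0 t0) (plug F1 t1)"
  using assms
proof (induction n arbitrary: t0 t1 F0 F1 rule: less_induct)
  case (less n)
  show ?case
  proof (cases t0 rule: value_or_control_stuck_cases)
    case (val v)
    with less.prems(1) obtain v1 where "red\<^sup>*\<^sup>* t1 (Val v1)" "vrel n v v1" by (auto dest: trel_ValD)
    then show ?thesis using val crelD[OF less.prems(2)] by (blast intro: trel_reds reds_plug)
  next
    case (stuck E0 s0)
    with less.prems(1) obtain E1 s1
      where t1: "pure E1" "red\<^sup>*\<^sup>* t1 (plug E1 (Shift s1))" and st: "stuck_rel n E0 s0 E1 s1"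
      by (auto dest: trel_stuckD)
    from less.prems(3) show ?thesis
    proof (elim disjE conjE)
      assume F: "pure F0" "pure F1"
      have "stuck_rel n (ctx_comp F0 E0) s0 (ctx_comp F1 E1) s1"
        unfolding stuck_rel_def
      proof (intro allI impI, elim conjE)
        fix m D0 D1 assume m: "m < n" and D: "reset_ctx D0" "reset_ctx D1" "crel m D0 D1"
        \<comment> \<open>A later capture takes \<open>F0\<close> along with \<open>D0\<close>. The
          enlarged contexts are related by the induction hypothesis, as \<open>k\<close> is below
          \<open>n\<close>.\<close>
        have "crel m (ctx_comp D0 F0) (ctx_comp D1 F1)"
          unfolding crel_def plug_ctx_comp
        proof (intro allI impI)
          fix k u0 u1 assume k: "k \<le> m" "vrel k u0 u1"
          show "trel k (plug D0 (plug F0 (Val u0))) (plug D1 (plug F1 (Val u1)))"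
            using k m D less.prems(2) crel_mono[of n F0 F1 k] crel_mono[of m D0 D1 k]
            by (intro less.IH crelD) auto
        qed
        with st m D F show "trel m (Reset (inst s0 (reify (ctx_comp D0 (ctx_comp F0 E0)))))
            (Reset (inst s1 (reify (ctx_comp D1 (ctx_comp F1 E1)))))"
          unfolding stuck_rel_def ctx_comp_assoc[symmetric] by (blast intro: reset_ctx_comp)
      qed
      moreover have "red\<^sup>*\<^sup>* (plug F1 t1) (plug (ctx_comp F1 E1) (Shift s1))"
        using reds_plug[OF t1(2)] by (simp add: plug_ctx_comp)
      ultimately have "trel n (plug (ctx_comp F0 E0) (Shift s0)) (plug F1 t1)"
        using F stuck t1 by (intro trel_stuckI) (auto simp: pure_ctx_comp_iff)
      then show ?thesis using stuck by (simp add: plug_ctx_comp)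
    next
      assume F: "reset_ctx F0" "reset_ctx F1"
      note sh = red.shift[OF reset_ctx_delimited[OF reset_ctx_comp], where F = FHole,
          simplified plug_ctx_comp plug.simps]
      \<comment> \<open>Here the capture happens on both sides; the left-hand step pays for the
        strict bound in \<open>stuck_rel\<close>.\<close>
      have "red\<^sup>*\<^sup>* (plug F1 t1) (Reset (inst s1 (reify (ctx_comp F1 E1))))"
        using reds_plug[OF t1(2)] sh[OF F(2) t1(1)] by (rule rtranclp.rtrancl_into_rtrancl)
      moreover have "red (plug F0 t0) (Reset (inst s0 (reify (ctx_comp F0 E0))))"
        using sh[OF F(1) stuck(1)] stuck(2) by simp
      moreover have "trel m (Reset (inst s0 (reify (ctx_comp F0 E0))))
          (Reset (inst s1 (reify (ctx_comp F1 E1))))" if "n = Suc m" for m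
        using st F that crel_mono[OF less.prems(2), of m] unfolding stuck_rel_def by auto
      ultimately show ?thesis by (meson trel_redI trel_reds)
    qed
  next
    case other
    then show ?thesis
      using less.prems(2,3) by (intro trel_plug_stepI[OF less.prems(1)] less.IH) (auto intro: crel_mono)
  qed
qed

lemma not_control_stuck_Reset: "\<not> control_stuck (plug F (Reset t))"
proof
  assume "control_stuck (plug F (Reset t))"
  then have "control_stuck (Reset t)"
    using control_stuck_plug by (auto simp: control_stuck_def[of "plug F (Reset t)"] is_value_def)
  then obtain E s where "pure E" "Reset t = plug E (Shift s)" by (auto simp: control_stuck_def)
  then show False by (cases E) auto
qed

text \<open>The invariant behind \<open>trel_plug_Reset\<close>: the outer \<open>Reset\<close>
  disappears only when its body is a value, so no control effect ever escapes.\<close>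

lemma red_Reset:
  assumes "red (Reset t) t'"
  shows "is_value t' \<or> (\<exists>s. t' = Reset s)"
  using assms
proof cases
  case (beta F s v)
  then show ?thesis by (cases F) auto
next
  case (shift D F s)
  then show ?thesis by (cases F) auto
next
  case (reset F v)
  then show ?thesis by (cases F) (auto simp: is_value_def)
qed

text \<open>Neither \<open>t0\<close> nor any of its reducts is control-stuck, so the contexts are
  never captured and their shape may be arbitrary.\<close>

lemma trel_plug_Reset:
  assumes "trel n t0 t1" "crel n F0 F1" "is_value t0 \<or> (\<exists>s. t0 = Reset s)"
  shows "trel n (plug F0 t0) (plug F1 t1)"
  using assms
proof (induction n arbitrary: t0 rule: less_induct)
  case (less n)
  show ?case
  proof (cases "is_value t0")
    case True
    then obtain v where v: "t0 = Val v" by (auto simp: is_value_def)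
    with less.prems(1) obtain v1 where "red\<^sup>*\<^sup>* t1 (Val v1)" "vrel n v v1" by (auto dest: trel_ValD)
    then show ?thesis using v crelD[OF less.prems(2)] by (blast intro: trel_reds reds_plug)
  next
    case False
    with less.prems(3) obtain s where s: "t0 = Reset s" by blast
    show ?thesis
      by (intro trel_plug_stepI[OF less.prems(1) False] less.IH)
         (use s red_Reset not_control_stuck_Reset[of FHole] less.prems(2) in \<open>auto intro: crel_mono\<close>)
  qed
qed

lemma reset_ctx_plug: "reset_ctx D \<Longrightarrow> \<exists>s. plug D t = Reset s"
  by (auto elim: reset_ctx.cases)

lemma not_control_stuck_App: "\<not> control_stuck (App (Val v) (Val u))"
proof
  assume "control_stuck (App (Val v) (Val u))"
  then obtain E s where "pure E" "App (Val v) (Val u) = plug E (Shift s)" by (auto simp: control_stuck_def)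
  then show False by (cases E) (auto simp: plug_eq_Val_iff)
qed

lemma trel_App_Val: "vrel n v0 v1 \<Longrightarrow> vrel n u0 u1 \<Longrightarrow>
  trel n (App (Val v0) (Val u0)) (App (Val v1) (Val u1))"
  by (rule trel_stepI)
     (auto simp: is_value_def not_control_stuck_App elim!: vrelD intro: vrel_mono)


section \<open>Simulations are contained in the logical relation\<close>

definition subst_rel ::
  "nat \<Rightarrow> (nat \<Rightarrow> val) \<Rightarrow> (nat \<Rightarrow> val) \<Rightarrow> (nat \<Rightarrow> fctx) \<Rightarrow> (nat \<Rightarrow> fctx) \<Rightarrow> bool" where
  "subst_rel n \<sigma>0 \<sigma>1 \<theta>0 \<theta>1 \<longleftrightarrow> (\<forall>x. vrel n (\<sigma>0 x) (\<sigma>1 x)) \<and>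
     (\<forall>\<alpha>. reset_ctx (\<theta>0 \<alpha>) \<and> reset_ctx (\<theta>1 \<alpha>) \<and> crel n (\<theta>0 \<alpha>) (\<theta>1 \<alpha>))"

text \<open>The index is a parameter so that soundness at smaller indices can serve as an induction
  hypothesis.\<close>

definition sound :: "(trm \<Rightarrow> trm \<Rightarrow> bool) \<Rightarrow> nat \<Rightarrow> bool" where
  "sound R n \<longleftrightarrow> (\<forall>t0 t1 \<sigma>0 \<sigma>1 \<theta>0 \<theta>1. R t0 t1 \<longrightarrow> subst_rel n \<sigma>0 \<sigma>1 \<theta>0 \<theta>1 \<longrightarrow>
     trel n (msubst \<sigma>0 \<theta>0 t0) (msubst \<sigma>1 \<theta>1 t1))"

lemma soundD:
  "sound R n \<Longrightarrow> R t0 t1 \<Longrightarrow> subst_rel n \<sigma>0 \<sigma>1 \<theta>0 \<theta>1 \<Longrightarrow>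
    trel n (msubst \<sigma>0 \<theta>0 t0) (msubst \<sigma>1 \<theta>1 t1)"
  by (simp add: sound_def)

lemma subst_rel_mono: "subst_rel n \<sigma>0 \<sigma>1 \<theta>0 \<theta>1 \<Longrightarrow> k \<le> n \<Longrightarrow> subst_rel k \<sigma>0 \<sigma>1 \<theta>0 \<theta>1"
  unfolding subst_rel_def by (blast intro: vrel_mono crel_mono)

lemma subst_rel_upd:
  "subst_rel n \<sigma>0 \<sigma>1 \<theta>0 \<theta>1 \<Longrightarrow> k \<le> n \<Longrightarrow> vrel k u0 u1 \<Longrightarrow>
    subst_rel k (\<sigma>0(x := u0)) (\<sigma>1(x := u1)) \<theta>0 \<theta>1"
  using subst_rel_mono[of n \<sigma>0 \<sigma>1 \<theta>0 \<theta>1 k] by (simp add: subst_rel_def)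

lemma subst_rel_reset_ctx:
  "subst_rel n \<sigma>0 \<sigma>1 \<theta>0 \<theta>1 \<Longrightarrow> reset_ctx (\<theta>0 \<alpha>)"
  "subst_rel n \<sigma>0 \<sigma>1 \<theta>0 \<theta>1 \<Longrightarrow> reset_ctx (\<theta>1 \<alpha>)"
  by (simp_all add: subst_rel_def)

lemma msubst_val_upd: "x \<notin> fv_val v \<Longrightarrow> msubst_val (\<sigma>(x := u)) \<theta> v = msubst_val \<sigma> \<theta> v"
  by (rule msubst_cong) auto

lemma msubst_ctx_upd: "x \<notin> fv_ctx F \<Longrightarrow> msubst_ctx (\<sigma>(x := u)) \<theta> F = msubst_ctx \<sigma> \<theta> F"
  by (rule msubst_ctx_cong) auto

section \<open>Clauses of a simulation in usable form\<close>

lemma refined_simulation_red: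
  "refined_simulation R \<Longrightarrow> R t0 t1 \<Longrightarrow> red t0 t0' \<Longrightarrow> \<exists>t1'. red\<^sup>*\<^sup>* t1 t1' \<and> R t0' t1'"
  unfolding refined_simulation_def by blast

lemma refined_simulation_Val:
  "refined_simulation R \<Longrightarrow> R (Val v0) t1 \<Longrightarrow> \<exists>v1. red\<^sup>*\<^sup>* t1 (Val v1) \<and> rel_val R v0 v1"
  unfolding refined_simulation_def evals_def by blast

lemma refined_simulation_ctx_stuck:
  "refined_simulation R \<Longrightarrow> R (plug F0 (CVar \<alpha> (Val v0))) t1 \<Longrightarrow>
    \<exists>F1 v1. red\<^sup>*\<^sup>* t1 (plug F1 (CVar \<alpha> (Val v1))) \<and>
      rel_ctx R (ctx_comp F0 (FReset FHole)) (ctx_comp F1 (FReset FHole)) \<and> rel_val R v0 v1"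
  unfolding refined_simulation_def evals_def by blast

text \<open>\<open>rel_nf\<close> chooses its own decomposition of the left-hand term; unique
  decomposition identifies it with the given one and rules out the control-stuck clause.\<close>

lemma refined_simulation_open_stuck:
  assumes "refined_simulation R" "R (plug F0 (App (Val (Var y)) (Val v0))) t1"
  obtains F1 v1 where "red\<^sup>*\<^sup>* t1 (plug F1 (App (Val (Var y)) (Val v1)))"
    "rel_ctx R F0 F1" "rel_val R v0 v1"
proof -
  let ?t0 = "plug F0 (App (Val (Var y)) (Val v0))"
  have "open_stuck ?t0" by (auto simp: open_stuck_def)
  with assms obtain t1' where t1': "red\<^sup>*\<^sup>* t1 t1'" "rel_nf R ?t0 t1'"
    unfolding refined_simulation_def evals_def by blast
  from t1'(2) show thesis
  proof cases
    case (open_stuck G0 G1 w0 w1 z)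
    from plug_head_unique[OF open_stuck(1)] have "G0 = F0" "w0 = v0" "z = y"
      by (auto intro: head.intros)
    with open_stuck t1'(1) that show thesis by blast
  next
    case (control_stuck E0 E1 \<alpha> s0 s1)
    from plug_head_unique[OF control_stuck(1)] show thesis by (auto intro: head.intros)
  qed
qed

lemma refined_simulation_control_stuck:
  assumes "refined_simulation R" "R (plug E0 (Shift s0)) t1" "pure E0"
  obtains E1 s1 \<alpha> where "red\<^sup>*\<^sup>* t1 (plug E1 (Shift s1))" "pure E1"
    "\<alpha> \<notin> cv_ctx E0 \<union> cv s0 \<union> cv_ctx E1 \<union> cv s1"
    "R (Reset (inst s0 (reify (FCVar \<alpha> E0)))) (Reset (inst s1 (reify (FCVar \<alpha> E1))))"
proof -
  let ?t0 = "plug E0 (Shift s0)"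
  have "control_stuck ?t0" using assms(3) by (auto simp: control_stuck_def)
  with assms obtain t1' where t1': "red\<^sup>*\<^sup>* t1 t1'" "rel_nf R ?t0 t1'"
    unfolding refined_simulation_def evals_def by blast
  from t1'(2) show thesis
  proof cases
    case (open_stuck G0 G1 w0 w1 z)
    from plug_head_unique[OF open_stuck(1)] show thesis by (auto intro: head.intros)
  next
    case (control_stuck G0 G1 \<alpha> r0 r1)
    from plug_head_unique[OF control_stuck(1)] have "G0 = E0" "r0 = s0"
      by (auto intro: head.intros)
    with control_stuck t1'(1) that show thesis by blast
  qed
qed

text \<open>The fresh \<open>x\<close> is instantiated with the arbitrary related arguments;
  freshness leaves the contexts unchanged.\<close>

lemma crel_msubst_ctx:
  assumes "\<And>k. k \<le> n \<Longrightarrow> sound R k" "subst_rel n \<sigma>0 \<sigma>1 \<theta>0 \<theta>1"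
    and "x \<notin> fv_ctx F0 \<union> fv_ctx F1" "R (plug F0 (Val (Var x))) (plug F1 (Val (Var x)))"
  shows "crel n (msubst_ctx \<sigma>0 \<theta>0 F0) (msubst_ctx \<sigma>1 \<theta>1 F1)"
  unfolding crel_def
proof (intro allI impI)
  fix k u0 u1 assume k: "k \<le> n" "vrel k u0 u1"
  from soundD[OF assms(1)[OF k(1)] assms(4) subst_rel_upd[OF assms(2) k, of x]] assms(3)
  show "trel k (plug (msubst_ctx \<sigma>0 \<theta>0 F0) (Val u0)) (plug (msubst_ctx \<sigma>1 \<theta>1 F1) (Val u1))"
    by (simp add: msubst_plug msubst_ctx_upd)
qed

text \<open>In the delimited case the inner contexts are filled first. The left-hand result is a
  \<open>Reset\<close> term, so the outer contexts need no common shape.\<close>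

lemma trel_plug_rel_ctx:
  assumes snd: "\<And>k. k \<le> n \<Longrightarrow> sound R k" and sub: "subst_rel n \<sigma>0 \<sigma>1 \<theta>0 \<theta>1"
    and "rel_ctx R F0 F1" and t: "trel n t0 t1"
  shows "trel n (plug (msubst_ctx \<sigma>0 \<theta>0 F0) t0) (plug (msubst_ctx \<sigma>1 \<theta>1 F1) t1)"
  using assms(3)
proof cases
  case (pure x)
  then show ?thesis
    by (intro trel_plug t crel_msubst_ctx[OF snd sub]) (auto intro: pure_msubst_ctx)
next
  case (delimited D0 D1 x G0 G1)
  have D: "reset_ctx (msubst_ctx \<sigma>0 \<theta>0 D0)" "reset_ctx (msubst_ctx \<sigma>1 \<theta>1 D1)"
    using delimited(3,4) subst_rel_reset_ctx[OF sub] by (auto intro: reset_ctx_msubst_ctx)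
  have "trel n (plug (msubst_ctx \<sigma>0 \<theta>0 D0) t0) (plug (msubst_ctx \<sigma>1 \<theta>1 D1) t1)"
    using delimited D by (intro trel_plug t crel_msubst_ctx[OF snd sub, of x]) auto
  moreover have "crel n (msubst_ctx \<sigma>0 \<theta>0 G0) (msubst_ctx \<sigma>1 \<theta>1 G1)"
    using delimited by (intro crel_msubst_ctx[OF snd sub, of x]) auto
  ultimately show ?thesis
    unfolding delimited(1,2) msubst_ctx_comp plug_ctx_comp
    using reset_ctx_plug[OF D(1)] by (blast intro: trel_plug_Reset)
qed

text \<open>
  For \<open>v0 = Lam b\<close> the step of the application is a step of the simulation. For a variable \<open>y\<close>,
  it is the value substituted for \<open>y\<close> that steps, and the context and the argument that the
  simulation produces on the right are related to the empty context and to \<open>x\<close>. Both cases need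
  \<open>sound\<close> at smaller indices only, which is what makes the induction of \<open>sound_simulation\<close> work.
\<close>

lemma vrel_rel_val:
  assumes sim: "refined_simulation R" and snd: "\<And>m. m < n \<Longrightarrow> sound R m"
    and "rel_val R v0 v1" and "subst_rel n \<sigma>0 \<sigma>1 \<theta>0 \<theta>1"
  shows "vrel n (msubst_val \<sigma>0 \<theta>0 v0) (msubst_val \<sigma>1 \<theta>1 v1)"
  using snd assms(3,4)
proof (induction n arbitrary: v0 v1 \<sigma>0 \<sigma>1 rule: less_induct)
  case (less n)
  from less.prems(2) obtain x where x: "x \<notin> fv_val v0" "x \<notin> fv_val v1"
    and R: "R (App (Val v0) (Val (Var x))) (App (Val v1) (Val (Var x)))"
    by (auto elim: rel_val.cases)
  note sub = less.prems(3)
  show ?case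
  proof (rule vrelI)
    fix m u0 u1 t
    assume m: "m < n" and u: "vrel m u0 u1" and
      red: "red (App (Val (msubst_val \<sigma>0 \<theta>0 v0)) (Val u0)) t"
    let ?\<sigma>0 = "\<sigma>0(x := u0)" and ?\<sigma>1 = "\<sigma>1(x := u1)"
    have sub': "subst_rel m ?\<sigma>0 ?\<sigma>1 \<theta>0 \<theta>1" using sub m u by (intro subst_rel_upd) auto
    have eq0: "App (Val (msubst_val \<sigma>0 \<theta>0 v0)) (Val u0) = msubst ?\<sigma>0 \<theta>0 (App (Val v0) (Val (Var x)))"
      and eq1: "App (Val (msubst_val \<sigma>1 \<theta>1 v1)) (Val u1) = msubst ?\<sigma>1 \<theta>1 (App (Val v1) (Val (Var x)))"
      using x by (simp_all add: msubst_val_upd)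
    show "trel m t (App (Val (msubst_val \<sigma>1 \<theta>1 v1)) (Val u1))"
    proof (cases v0)
      case (Lam b)
      have step: "red (App (Val v0) (Val (Var x))) (inst b (Var x))"
        using red.beta[of FHole b "Var x"] Lam by simp
      with refined_simulation_red[OF sim R] obtain t1' where
        t1': "red\<^sup>*\<^sup>* (App (Val v1) (Val (Var x))) t1'" "R (inst b (Var x)) t1'" by blast
      have "t = msubst ?\<sigma>0 \<theta>0 (inst b (Var x))"
        using red red_msubst[where \<theta> = \<theta>0, OF step subst_rel_reset_ctx(1)[OF sub]] red_deterministic
        unfolding eq0 by blast
      moreover have "trel m (msubst ?\<sigma>0 \<theta>0 (inst b (Var x))) (msubst ?\<sigma>1 \<theta>1 t1')"
        using soundD[OF less.prems(1)[OF m] t1'(2) sub'] .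
      ultimately show ?thesis
        unfolding eq1 using reds_msubst[where \<theta> = \<theta>1, OF t1'(1) subst_rel_reset_ctx(2)[OF sub]] trel_reds by blast
    next
      case (Var y)
      have "R (plug FHole (App (Val (Var y)) (Val (Var x)))) (App (Val v1) (Val (Var x)))"
        using R Var by simp
      from refined_simulation_open_stuck[OF sim this] obtain F1 w1 where
        t1': "red\<^sup>*\<^sup>* (App (Val v1) (Val (Var x))) (plug F1 (App (Val (Var y)) (Val w1)))"
        and F1: "rel_ctx R FHole F1" and w1: "rel_val R (Var x) w1" by blast
      have y: "y \<noteq> x" using x Var by auto
      \<comment> \<open>The induction hypothesis on the index is used with \<open>Var x\<close>,
        which the updated substitution sends to \<open>u0\<close>.\<close>
      have "vrel m (msubst_val ?\<sigma>0 \<theta>0 (Var x)) (msubst_val ?\<sigma>1 \<theta>1 w1)"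
        using less.IH[OF m less.prems(1) w1 sub'] m by (simp del: fun_upd_apply)
      moreover have "vrel n (\<sigma>0 y) (\<sigma>1 y)" using sub by (simp add: subst_rel_def)
      ultimately have "trel m t (App (Val (\<sigma>1 y)) (Val (msubst_val ?\<sigma>1 \<theta>1 w1)))"
        using red Var m by (auto intro: vrelD)
      from trel_plug_rel_ctx[OF less.prems(1) sub' F1 this] m
      have "trel m t (plug (msubst_ctx ?\<sigma>1 \<theta>1 F1) (App (Val (\<sigma>1 y)) (Val (msubst_val ?\<sigma>1 \<theta>1 w1))))"
        by simp
      then show ?thesis
        unfolding eq1 using reds_msubst[where \<theta> = \<theta>1 and \<sigma> = ?\<sigma>1, OF t1' subst_rel_reset_ctx(2)[OF sub]] y
        by (auto simp: msubst_plug intro: trel_reds)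
    qed
  qed
qed

lemma sound_simulation:
  assumes sim: "refined_simulation R"
  shows "sound R n"
proof (induction n rule: less_induct)
  case (less n)
  show ?case unfolding sound_def
  proof (intro allI impI)
    fix t0 t1 \<sigma>0 \<sigma>1 \<theta>0 \<theta>1
    assume R: "R t0 t1" and sub: "subst_rel n \<sigma>0 \<sigma>1 \<theta>0 \<theta>1"
    note rst = subst_rel_reset_ctx[OF sub]
    \<comment> \<open>Values become related at \<open>n\<close> itself, since this uses soundness
      only below \<open>n\<close>.\<close>
    note vals = vrel_rel_val[OF sim less.IH _ sub]
    have reds: "trel n s (msubst \<sigma>1 \<theta>1 t1)"
      if "red\<^sup>*\<^sup>* t1 t1'" "trel n s (msubst \<sigma>1 \<theta>1 t1')" for t1' s
      using that(2) reds_msubst[where \<theta> = \<theta>1, OF that(1) rst(2)] by (rule trel_reds)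
    show "trel n (msubst \<sigma>0 \<theta>0 t0) (msubst \<sigma>1 \<theta>1 t1)"
    proof (cases t0 rule: term_cases)
      case (red t0')
      with refined_simulation_red[OF sim R] obtain t1' where t1': "red\<^sup>*\<^sup>* t1 t1'" "R t0' t1'" by blast
      show ?thesis
      proof (rule reds[OF t1'(1)], rule trel_redI[OF red_msubst[where \<theta> = \<theta>0, OF red rst(1)]])
        fix m assume m: "n = Suc m"
        then show "trel m (msubst \<sigma>0 \<theta>0 t0') (msubst \<sigma>1 \<theta>1 t1')"
          using sub by (intro soundD[OF less.IH t1'(2)]) (auto intro: subst_rel_mono)
      qed
    next
      case (val v0)
      with refined_simulation_Val[OF sim] R obtain v1 where
        "red\<^sup>*\<^sup>* t1 (Val v1)" "rel_val R v0 v1" by blast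
      moreover from this have "trel n (msubst \<sigma>0 \<theta>0 (Val v0)) (msubst \<sigma>1 \<theta>1 (Val v1))"
        using vals by (auto intro: trel_ValI)
      ultimately show ?thesis using val reds by blast
    next
      case (open_stuck F0 y v0)
      with R obtain F1 v1 where t1': "red\<^sup>*\<^sup>* t1 (plug F1 (App (Val (Var y)) (Val v1)))"
        and F: "rel_ctx R F0 F1" and v: "rel_val R v0 v1"
        by (blast elim: refined_simulation_open_stuck[OF sim])
      let ?v0 = "msubst_val \<sigma>0 \<theta>0 v0" and ?v1 = "msubst_val \<sigma>1 \<theta>1 v1"
      have "vrel n ?v0 ?v1" "vrel n (\<sigma>0 y) (\<sigma>1 y)"
        using vals[OF _ v] sub by (auto simp: subst_rel_def)
      then have app: "trel n (App (Val (\<sigma>0 y)) (Val ?v0)) (App (Val (\<sigma>1 y)) (Val ?v1))"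
        by (blast intro: trel_App_Val)
      have "trel n (plug (msubst_ctx \<sigma>0 \<theta>0 F0) (App (Val (\<sigma>0 y)) (Val ?v0)))
          (plug (msubst_ctx \<sigma>1 \<theta>1 F1) (App (Val (\<sigma>1 y)) (Val ?v1)))"
      \<comment> \<open>The application must step before the contexts matter, so the induction
        hypothesis covers them.\<close>
      proof (rule trel_plug_stepI[OF app])
        fix m s assume "n = Suc m" "trel m s (App (Val (\<sigma>1 y)) (Val ?v1))"
        then show "trel m (plug (msubst_ctx \<sigma>0 \<theta>0 F0) s)
            (plug (msubst_ctx \<sigma>1 \<theta>1 F1) (App (Val (\<sigma>1 y)) (Val ?v1)))"
          using subst_rel_mono[OF sub, of m] by (intro trel_plug_rel_ctx[OF less.IH _ F]) auto
      qed (simp_all add: is_value_def not_control_stuck_App)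
      then show ?thesis
        unfolding open_stuck by (intro reds[OF t1']) (simp add: msubst_plug)
    next
      case (control_stuck E0 s0)
      with R obtain E1 s1 \<alpha> where t1': "red\<^sup>*\<^sup>* t1 (plug E1 (Shift s1))" "pure E1"
        and \<alpha>: "\<alpha> \<notin> cv_ctx E0 \<union> cv s0 \<union> cv_ctx E1 \<union> cv s1"
        and R': "R (Reset (inst s0 (reify (FCVar \<alpha> E0)))) (Reset (inst s1 (reify (FCVar \<alpha> E1))))"
        by (blast elim: refined_simulation_control_stuck[OF sim])
      have "stuck_rel n (msubst_ctx \<sigma>0 \<theta>0 E0) (msubst (up \<sigma>0) (upc \<theta>0) s0)
          (msubst_ctx \<sigma>1 \<theta>1 E1) (msubst (up \<sigma>1) (upc \<theta>1) s1)"
        unfolding stuck_rel_def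
      proof (intro allI impI, elim conjE)
        fix m D0 D1 assume m: "m < n" and D: "reset_ctx D0" "reset_ctx D1" "crel m D0 D1"
        \<comment> \<open>The fresh \<open>\<alpha>\<close> of the bisimulation clause is
          instantiated with the contexts being captured.\<close>
        have sub': "subst_rel m \<sigma>0 \<sigma>1 (\<theta>0(\<alpha> := D0)) (\<theta>1(\<alpha> := D1))"
          using subst_rel_mono[OF sub, of m] m D by (simp add: subst_rel_def)
        have [simp]: "msubst_ctx \<sigma> (\<theta>(\<alpha> := D)) E = msubst_ctx \<sigma> \<theta> E" if "\<alpha> \<notin> cv_ctx E" for \<sigma> \<theta> D E
          using that by (intro msubst_ctx_cong) auto
        have [simp]: "msubst \<sigma> (upc (\<theta>(\<alpha> := D))) s = msubst \<sigma> (upc \<theta>) s" if "\<alpha> \<notin> cv s" for \<sigma> \<theta> D s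
          using that by (intro msubst_cong) auto
        from soundD[OF less.IH[OF m] R' sub'] \<alpha>
        show "trel m (Reset (inst (msubst (up \<sigma>0) (upc \<theta>0) s0) (reify (ctx_comp D0 (msubst_ctx \<sigma>0 \<theta>0 E0)))))
            (Reset (inst (msubst (up \<sigma>1) (upc \<theta>1) s1) (reify (ctx_comp D1 (msubst_ctx \<sigma>1 \<theta>1 E1)))))"
          \<comment> \<open>Updates stay folded at first so that the two freshness rules match;
            afterwards they are evaluated at \<open>\<alpha>\<close>.\<close>
          by (simp add: msubst_inst msubst_reify del: fun_upd_apply) (simp add: fun_upd_apply)
      qed
      then have "trel n (plug (msubst_ctx \<sigma>0 \<theta>0 E0) (Shift (msubst (up \<sigma>0) (upc \<theta>0) s0)))
          (plug (msubst_ctx \<sigma>1 \<theta>1 E1) (Shift (msubst (up \<sigma>1) (upc \<theta>1) s1)))"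
        using control_stuck t1'(2) by (blast intro: trel_stuckI pure_msubst_ctx)
      then show ?thesis
        unfolding control_stuck(2) by (intro reds[OF t1'(1)]) (simp add: msubst_plug)
    next
      case (ctx_stuck F0 \<alpha> v0)
      with refined_simulation_ctx_stuck[OF sim] R obtain F1 v1
        where t1': "red\<^sup>*\<^sup>* t1 (plug F1 (CVar \<alpha> (Val v1)))"
        and F: "rel_ctx R (ctx_comp F0 (FReset FHole)) (ctx_comp F1 (FReset FHole))"
        and v: "rel_val R v0 v1" by blast
      \<comment> \<open>The appended \<open>Reset\<close> is the innermost delimiter, so only the
        delimited clause applies and its outer contexts are exactly \<open>F0\<close> and
        \<open>F1\<close>.\<close>
      from F obtain x where x: "x \<notin> fv_ctx F0 \<union> fv_ctx F1"
        and RF: "R (plug F0 (Val (Var x))) (plug F1 (Val (Var x)))"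
      proof cases
        case (delimited D0 D1 x G0 G1)
        have "G0 = F0" "G1 = F1"
          using ctx_comp_delimited_unique[OF delimited(1)] ctx_comp_delimited_unique[OF delimited(2)]
            delimited(3,4) by (auto intro: delimited.intros pure.intros)
        with delimited that show thesis by blast
      qed (simp add: pure_ctx_comp_iff)
      let ?d0 = "plug (\<theta>0 \<alpha>) (Val (msubst_val \<sigma>0 \<theta>0 v0))"
        and ?d1 = "plug (\<theta>1 \<alpha>) (Val (msubst_val \<sigma>1 \<theta>1 v1))"
      obtain s0 where s0: "?d0 = Reset s0" using reset_ctx_plug[OF rst(1)] by blast
      have d: "trel n ?d0 ?d1" using vals[OF _ v] sub by (auto simp: subst_rel_def intro: crelD)
      have "trel n (plug (msubst_ctx \<sigma>0 \<theta>0 F0) ?d0) (plug (msubst_ctx \<sigma>1 \<theta>1 F1) ?d1)"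
      \<comment> \<open>\<open>?d0\<close> is a \<open>Reset\<close> term, hence not control-stuck.
        Its reducts are values or \<open>Reset\<close> terms, so the shapes of \<open>F0\<close> and
        \<open>F1\<close> do not matter.\<close>
      proof (rule trel_plug_stepI[OF d])
        fix m s assume m: "n = Suc m" and "trel m s ?d1" "red ?d0 s"
        moreover from this have "is_value s \<or> (\<exists>s'. s = Reset s')" using red_Reset s0 by simp
        moreover have "crel m (msubst_ctx \<sigma>0 \<theta>0 F0) (msubst_ctx \<sigma>1 \<theta>1 F1)"
          using m subst_rel_mono[OF sub, of m] by (intro crel_msubst_ctx[OF less.IH _ x RF]) auto
        ultimately show "trel m (plug (msubst_ctx \<sigma>0 \<theta>0 F0) s) (plug (msubst_ctx \<sigma>1 \<theta>1 F1) ?d1)"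
          by (blast intro: trel_plug_Reset)
      qed (use s0 not_control_stuck_Reset[of FHole] in \<open>simp_all add: is_value_def\<close>)
      then show ?thesis
        unfolding ctx_stuck by (intro reds[OF t1']) (simp add: msubst_plug)
    qed
  qed
qed


section \<open>Compatibility and soundness\<close>

text \<open>The extension to open terms, at all indices. It is meant for plain terms, so context
  variables are left uninstantiated.\<close>

definition lrel :: "trm \<Rightarrow> trm \<Rightarrow> bool" where
  "lrel t0 t1 \<longleftrightarrow> (\<forall>n \<sigma>0 \<sigma>1. (\<forall>x. vrel n (\<sigma>0 x) (\<sigma>1 x)) \<longrightarrow>
     trel n (subst \<sigma>0 t0) (subst \<sigma>1 t1))"

section \<open>Compatibility with the constructs of the plain calculus\<close>

lemma crel_FReset_FHole: "crel n (FReset FHole) (FReset FHole)"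
  unfolding crel_def
proof (intro allI impI)
  fix k u0 u1 assume u: "vrel k u0 u1"
  have r: "red (Reset (Val u)) (Val u)" for u using red.reset[of FHole] by simp
  have "trel k (Reset (Val u0)) (Reset (Val u1))"
    using u by (intro trel_redI[OF r] trel_ValI[OF r_into_rtranclp[of red, OF r]])
      (auto intro: vrel_mono)
  then show "trel k (plug (FReset FHole) (Val u0)) (plug (FReset FHole) (Val u1))" by simp
qed

lemma trel_Reset: "trel n t0 t1 \<Longrightarrow> trel n (Reset t0) (Reset t1)"
  using trel_plug[of n t0 t1 "FReset FHole" "FReset FHole"] crel_FReset_FHole
  by (simp add: reset_ctx.intros)

text \<open>Follows the evaluation order: related function values give related contexts for the
  argument, which in turn relate the contexts around the function.\<close>

lemma trel_App:
  assumes "trel n t0 t1" "trel n s0 s1"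
  shows "trel n (App t0 s0) (App t1 s1)"
proof -
  have "trel k (App (Val u0) s0) (App (Val u1) s1)" if "k \<le> n" "vrel k u0 u1" for k u0 u1
  proof -
    have "crel k (FAppR u0 FHole) (FAppR u1 FHole)"
      using that by (auto simp: crel_def intro: trel_App_Val vrel_mono)
    then show ?thesis
      using trel_plug[of k s0 s1 "FAppR u0 FHole" "FAppR u1 FHole"] trel_mono[OF assms(2) that(1)] by simp
  qed
  then have "crel n (FAppL FHole s0) (FAppL FHole s1)" by (simp add: crel_def)
  then show ?thesis using trel_plug[of n t0 t1 "FAppL FHole s0" "FAppL FHole s1"] assms(1) by simp
qed

lemma inst_subst_up: "inst (subst (up \<sigma>) t) v = subst (case_nat v \<sigma>) t"
  using inst_msubst_up[of \<sigma> cvar_ctx t v] by (simp add: subst_eq_msubst)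

lemma vrel_Lam:
  assumes "lrel t0 t1" "\<And>x. vrel n (\<sigma>0 x) (\<sigma>1 x)"
  shows "vrel n (Lam (subst (up \<sigma>0) t0)) (Lam (subst (up \<sigma>1) t1))"
proof (rule vrelI)
  fix m u0 u1 t
  assume m: "m < n" and u: "vrel m u0 u1"
    and red: "red (App (Val (Lam (subst (up \<sigma>0) t0))) (Val u0)) t"
  have r: "red (App (Val (Lam (subst (up \<sigma>) s))) (Val u)) (subst (case_nat u \<sigma>) s)" for \<sigma> s u
    using red.beta[of FHole "subst (up \<sigma>) s" u] by (simp add: inst_subst_up)
  have "trel m (subst (case_nat u0 \<sigma>0) t0) (subst (case_nat u1 \<sigma>1) t1)"
    using assms(1) vrel_mono[OF assms(2), of m] m u by (auto simp: lrel_def split: nat.split)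
  moreover have "t = subst (case_nat u0 \<sigma>0) t0" using red r red_deterministic by blast
  ultimately show "trel m t (App (Val (Lam (subst (up \<sigma>1) t1))) (Val u1))"
    using r trel_reds by blast
qed

text \<open>Serves \<open>lrel_Shift\<close>, where the continuation variable receives the reified
  captured contexts.\<close>

lemma vrel_reify:
  assumes "crel n D0 D1"
  shows "vrel n (reify D0) (reify D1)"
proof (rule vrelI)
  fix m u0 u1 t
  assume m: "m < n" and u: "vrel m u0 u1" and red: "red (App (Val (reify D0)) (Val u0)) t"
  have r: "red (App (Val (reify D)) (Val u)) (plug D (Val u))" for D u
    using red.beta[of FHole "plug (ren_ctx Suc D) (Val (Var 0))" u] by (simp add: reify_def inst_reify_body)
  have "trel m (plug D0 (Val u0)) (plug D1 (Val u1))" using crelD[OF crel_mono[OF assms] u] m by simp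
  moreover have "t = plug D0 (Val u0)" using red r red_deterministic by blast
  ultimately show "trel m t (App (Val (reify D1)) (Val u1))" using r trel_reds by blast
qed

lemma lrel_Val_Lam: "lrel t0 t1 \<Longrightarrow> lrel (Val (Lam t0)) (Val (Lam t1))"
  unfolding lrel_def[of "Val _"] by (auto intro!: trel_ValI vrel_Lam)

lemma lrel_App: "lrel t0 t1 \<Longrightarrow> lrel s0 s1 \<Longrightarrow> lrel (App t0 s0) (App t1 s1)"
  by (simp add: lrel_def trel_App)

lemma lrel_Reset: "lrel t0 t1 \<Longrightarrow> lrel (Reset t0) (Reset t1)"
  by (simp add: lrel_def trel_Reset)

lemma lrel_Shift:
  assumes "lrel t0 t1"
  shows "lrel (Shift t0) (Shift t1)"
  unfolding lrel_def
proof (intro allI impI)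
  fix n and \<sigma>0 \<sigma>1 :: "nat \<Rightarrow> val" assume \<sigma>: "\<forall>x. vrel n (\<sigma>0 x) (\<sigma>1 x)"
  have "stuck_rel n FHole (subst (up \<sigma>0) t0) FHole (subst (up \<sigma>1) t1)"
    unfolding stuck_rel_def
  proof (intro allI impI, elim conjE)
    fix m D0 D1 assume m: "m < n" and D: "crel m D0 D1"
    have "trel m (subst (case_nat (reify D0) \<sigma>0) t0) (subst (case_nat (reify D1) \<sigma>1) t1)"
      using assms[unfolded lrel_def] vrel_mono[OF \<sigma>[rule_format], of m] m vrel_reify[OF D]
      by (simp split: nat.split)
    then show "trel m (Reset (inst (subst (up \<sigma>0) t0) (reify (ctx_comp D0 FHole))))
        (Reset (inst (subst (up \<sigma>1) t1) (reify (ctx_comp D1 FHole))))"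
      by (simp add: inst_subst_up trel_Reset)
  qed
  then show "trel n (subst \<sigma>0 (Shift t0)) (subst \<sigma>1 (Shift t1))"
    using trel_stuckI[of FHole FHole "Shift (subst (up \<sigma>1) t1)" "subst (up \<sigma>1) t1"] by simp
qed

text \<open>The fundamental property of the logical relation; plainness removes the case of
  \<open>CVar\<close>.\<close>

lemma lrel_refl:
  "plain t \<Longrightarrow> lrel t t"
  "plain_val v \<Longrightarrow> lrel (Val v) (Val v)"
proof (induction t and v)
  case (Var x)
  then show ?case by (auto simp: lrel_def intro: trel_ValI)
qed (auto simp: plain_def plain_val_def intro: lrel_Val_Lam lrel_App lrel_Reset lrel_Shift)

lemma lrel_cplug: "plain_cctx C \<Longrightarrow> lrel t0 t1 \<Longrightarrow> lrel (cplug C t0) (cplug C t1)"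
  by (induction C) (auto intro: lrel_Val_Lam lrel_App lrel_Reset lrel_Shift lrel_refl)

lemma vrel_plain_val:
  assumes "plain_val v" "\<And>x. vrel n (\<sigma>0 x) (\<sigma>1 x)"
  shows "vrel n (subst_val \<sigma>0 v) (subst_val \<sigma>1 v)"
proof (cases v)
  case (Lam t)
  then show ?thesis using assms vrel_Lam lrel_refl by (simp add: plain_val_def plain_def)
qed (use assms in simp)

lemma lrel_simulation:
  assumes "refined_simulation R" "R t0 t1" "plain t0" "plain t1"
  shows "lrel t0 t1"
  unfolding lrel_def
proof (intro allI impI)
  fix n and \<sigma>0 \<sigma>1 :: "nat \<Rightarrow> val" assume \<sigma>: "\<forall>x. vrel n (\<sigma>0 x) (\<sigma>1 x)"
  \<comment> \<open>An arbitrary related choice, as plain terms contain no context variable.\<close>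
  let ?\<theta> = "\<lambda>_. FReset FHole"
  have plain: "subst \<sigma> t = msubst \<sigma> ?\<theta> t" if "plain t" for \<sigma> t
    unfolding subst_eq_msubst using that by (intro msubst_cong) (auto simp: plain_def)
  have "subst_rel n \<sigma>0 \<sigma>1 ?\<theta> ?\<theta>"
    using \<sigma> crel_FReset_FHole by (simp add: subst_rel_def reset_ctx.intros)
  with soundD[OF sound_simulation] assms show "trel n (subst \<sigma>0 t0) (subst \<sigma>1 t1)"
    by (simp add: plain)
qed

lemma lrel_subst:
  assumes "lrel t0 t1" "\<And>x. x \<in> fv t0 \<union> fv t1 \<Longrightarrow> plain_val (\<sigma> x)"
  shows "lrel (subst \<sigma> t0) (subst \<sigma> t1)"
  unfolding lrel_def
proof (intro allI impI)
  fix n and \<sigma>0 \<sigma>1 :: "nat \<Rightarrow> val" assume \<sigma>01: "\<forall>x. vrel n (\<sigma>0 x) (\<sigma>1 x)"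
  \<comment> \<open>\<open>\<sigma>\<close> is controlled only on the free variables of the two
    terms; elsewhere it is replaced by the identity so that all its values are plain.\<close>
  define \<tau> where "\<tau> x = (if x \<in> fv t0 \<union> fv t1 then \<sigma> x else Var x)" for x
  have \<tau>: "plain_val (\<tau> x)" for x using assms(2) by (auto simp: \<tau>_def plain_val_def)
  have eq: "subst \<sigma>' (subst \<sigma> t) = subst (\<lambda>x. subst_val \<sigma>' (\<tau> x)) t" if "fv t \<subseteq> fv t0 \<union> fv t1" for \<sigma>' t
    unfolding subst_eq_msubst msubst_msubst using that
    by (intro msubst_cong) (auto simp: \<tau>_def)
  from assms(1) \<sigma>01 \<tau> show "trel n (subst \<sigma>0 (subst \<sigma> t0)) (subst \<sigma>1 (subst \<sigma> t1))"
    by (simp add: eq lrel_def vrel_plain_val)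
qed

section \<open>Adequacy for the two observations\<close>

lemma trel_of_lrel: "lrel t0 t1 \<Longrightarrow> trel n t0 t1"
proof -
  \<comment> \<open>An application of a variable is stuck, so this holds vacuously and the identity
    substitution is admissible.\<close>
  have "vrel n (Var x) (Var x)" for x
  proof (rule vrelI)
    fix u0 t assume "red (App (Val (Var x)) (Val u0)) t"
    then have "red (plug FHole (App (Val (Var x)) (Val u0))) t" by simp
    then show "trel m t s" for m s by (rule red_head_cases) (auto intro: head.intros)
  qed
  moreover assume "lrel t0 t1"
  ultimately have "trel n (subst Var t0) (subst Var t1)" by (simp add: lrel_def)
  then show ?thesis by (simp add: subst_eq_msubst)
qed

text \<open>Each left-hand step costs one index, so the relation is assumed at all of them.\<close>

lemma trel_reds_left:
  assumes "red\<^sup>*\<^sup>* t0 t" "\<And>n. trel n t0 t1"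
  shows "trel n t t1"
  using assms(1)
proof (induction arbitrary: n)
  case base
  show ?case by (rule assms(2))
next
  case (step s t)
  then show ?case by (blast intro: trel_redD)
qed

lemma lrel_evals:
  assumes "lrel t0 t1"
  shows "t0 \<Down> Val v0 \<Longrightarrow> \<exists>v1. t1 \<Down> Val v1"
    and "control_stuck s0 \<Longrightarrow> t0 \<Down> s0 \<Longrightarrow> \<exists>s1. control_stuck s1 \<and> t1 \<Down> s1"
proof -
  \<comment> \<open>Index 0 suffices at the end: the value and control-stuck clauses of
    \<open>trel\<close> yield the right-hand reduction at every index.\<close>
  have left: "trel 0 t t1" if "t0 \<Down> t" for t
    using that trel_reds_left[OF _ trel_of_lrel[OF assms]] by (simp add: evals_def)
  show "\<exists>v1. t1 \<Down> Val v1" if "t0 \<Down> Val v0"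
    using trel_ValD[OF left[OF that]] by (auto simp: evals_def normal_form_def is_value_def)
  show "\<exists>s1. control_stuck s1 \<and> t1 \<Down> s1" if "control_stuck s0" "t0 \<Down> s0"
  proof -
    from that(1) obtain E0 r0 where E0: "pure E0" "s0 = plug E0 (Shift r0)" by (auto simp: control_stuck_def)
    with trel_stuckD[of 0 E0 r0 t1] left[OF that(2)] obtain E1 r1
      where "pure E1" "red\<^sup>*\<^sup>* t1 (plug E1 (Shift r1))" by blast
    then show ?thesis
      by (intro exI[of _ "plug E1 (Shift r1)"])
         (auto simp: control_stuck_def evals_def normal_form_def not_red_control_stuck)
  qed
qed

theorem theorem6p19:
  fixes t\<^sub>0 t\<^sub>1 :: trm
  assumes "plain t\<^sub>0" and "plain t\<^sub>1"
    and "t\<^sub>0 \<approx>\<^sub>r t\<^sub>1"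
  shows "t\<^sub>0 \<cong>\<degree> t\<^sub>1 \<and> (closed t\<^sub>0 \<and> closed t\<^sub>1 \<longrightarrow> t\<^sub>0 \<cong> t\<^sub>1)"
proof -
  from assms(3) obtain R where R: "refined_simulation R" "refined_simulation R\<inverse>\<inverse>" "R t\<^sub>0 t\<^sub>1"
    by (auto simp: refined_bisimilar_def refined_bisimulation_def)
  \<comment> \<open>The logical relation is asymmetric, as it counts left-hand steps only; each
    direction comes from one of the two simulations.\<close>
  have l: "lrel t\<^sub>0 t\<^sub>1" and r: "lrel t\<^sub>1 t\<^sub>0"
    using lrel_simulation[OF R(1,3) assms(1,2)] lrel_simulation[OF R(2) _ assms(2,1)] R(3) by auto
  have ctx: "s0 \<cong> s1" if "lrel s0 s1" "lrel s1 s0" for s0 s1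
    unfolding ctx_equiv_def using that lrel_cplug lrel_evals by meson
  have "t\<^sub>0 \<cong>\<degree> t\<^sub>1" unfolding open_ctx_equiv_def using l r by (auto intro!: ctx lrel_subst)
  with ctx[OF l r] show ?thesis by simp
qed

end
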